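(* Let $E$ be a vector lattice with the countable sup property, and suppose that $E$ has an order dense ideal $F$ such that $F^\sim_{\mathrm{oc}}$ separates the points of $F$. Let $G$ be a regular vector sublattice of $E$. Then $G$ admits a (necessarily unique) Hausdorff uo-Lebesgue topology $\widehat\tau_G$. Let $(x_\alpha)_{\alpha\in\mathcal A}$ be a net in $G$ and suppose that $x_\alpha\to x$ in $\widehat\tau_G$ for some $x\in G$. Take a sequence $(\alpha'_n)_{n=1}^\infty$ of indices in $\mathcal A$. Then there exists an increasing sequence $\alpha'_1=\alpha_1\le\alpha_2\le\cdots$ of indices in $\mathcal A$ such that $\alpha_n\ge\alpha'_n$ for all $n\ge 1$ and $x_{\alpha_n}\xrightarrow{\mathrm{uo}}x$ in $G$ (as $n\to\infty$). In particular, when a sequence $(x_n)_{n=1}^\infty$ in $G$ and $x\in G$ are such that $x_n\to x$ in $\widehat\tau_G$, then there exists a subsequence $(x_{n_k})_{k=1}^\infty$ of $(x_n)_{n=1}^\infty$ such that $x_{n_k}\xrightarrow{\mathrm{uo}}x$ in $G$.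
   Context: All vector lattices are real and Archimedean. A vector lattice $E$ has the countable sup property if every non-empty subset of $E$ that has a supremum in $E$ has an at most countable subset with the same supremum. A vector sublattice $F$ of $E$ is order dense if for every $x\in E$ with $x>0$ there is $y\in F$ with $0<y\le x$; it is regular if for every net in $F$, $x_\alpha\downarrow 0$ in $F$ implies $x_\alpha\downarrow 0$ in $E$. A net $(x_\alpha)_{\alpha\in\mathcal A}$ in $E$ is order convergent to $x$ ($x_\alpha\xrightarrow{\mathrm o}x$) if there is a net $(y_\beta)_{\beta\in\mathcal B}$ in $E$ (possibly with a different index set) with $y_\beta\downarrow 0$ such that for every $\beta_0\in\mathcal B$ there is $\alpha_0\in\mathcal A$ with $|x-x_\alpha|\le y_{\beta_0}$ for all $\alpha\ge\alpha_0$; it is unbounded order convergent to $x$ ($x_\alpha\xrightarrow{\mathrm{uo}}x$) if $|x_\alpha-x|\wedge y\xrightarrow{\mathrm o}0$ in $E$ for all $y\in E^+$. $F^\sim_{\mathrm{oc}}$ is the space of order continuous linear functionals on $F$ (those mapping nets order convergent to $0$ to nets convergent to $0$). A uo-Lebesgue topology is a locally solid linear topology (a vector space topology, not necessarily Hausdorff, with a base of solid neighbourhoods of $0$) such that uo-convergence of a net to $x$ implies its topological convergence to $x$. *)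

theory Defs
  imports "HOL-Analysis.Analysis" "HOL-Library.Lattice_Algebras" "HOL-Library.Lub_Glb"
begin

class archimedean_vector_lattice = ordered_real_vector + lattice_ab_group_add_abs +
  assumes archimedean: "0 \<le> x \<Longrightarrow> (\<And>n::nat. real n *\<^sub>R x \<le> y) \<Longrightarrow> x = 0"

text \<open>
  The ambient vector lattice is a whole type. Its vector sublattices and ideals are subsets, and
  every order-theoretic or topological notion below takes as its first argument \<open>S\<close> the sublattice
  in which it is meant; suprema and infima relative to \<open>S\<close> are the library's \<^const>\<open>isLub\<close> \<open>S\<close> and
  \<^const>\<open>isGlb\<close> \<open>S\<close>.
\<close>

definition vector_sublattice :: "'a::archimedean_vector_lattice set \<Rightarrow> bool" where
  "vector_sublattice S \<longleftrightarrow>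
     subspace S \<and> (\<forall>x\<in>S. \<forall>y\<in>S. sup x y \<in> S \<and> inf x y \<in> S)"

definition solid_in :: "'a::archimedean_vector_lattice set \<Rightarrow> 'a set \<Rightarrow> bool" where
  "solid_in S V \<longleftrightarrow> V \<subseteq> S \<and> (\<forall>v\<in>V. \<forall>x\<in>S. \<bar>x\<bar> \<le> \<bar>v\<bar> \<longrightarrow> x \<in> V)"

definition order_ideal :: "'a::archimedean_vector_lattice set \<Rightarrow> bool" where
  "order_ideal F \<longleftrightarrow> subspace F \<and> solid_in UNIV F"

definition order_dense :: "'a::archimedean_vector_lattice set \<Rightarrow> bool" where
  "order_dense F \<longleftrightarrow> (\<forall>x. 0 < x \<longrightarrow> (\<exists>y\<in>F. 0 < y \<and> y \<le> x))"

definition countable_sup_property :: "'a::archimedean_vector_lattice set \<Rightarrow> bool" where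
  "countable_sup_property S \<longleftrightarrow>
     (\<forall>M s. M \<subseteq> S \<and> M \<noteq> {} \<and> isLub S M s \<longrightarrow>
        (\<exists>C. C \<subseteq> M \<and> countable C \<and> isLub S C s))"

text \<open>
  Nets are functions on a directed set \<open>A\<close> of indices, which is nonempty and preordered by \<open>le\<close>;
  antisymmetry is not required. \<open>tails A le\<close> is the filter generated by the sets
  \<open>{b \<in> A. le a b}\<close>, so that convergence of a net in a topology is \<^const>\<open>limitin\<close> along it.
\<close>

definition directed_set :: "'i set \<Rightarrow> ('i \<Rightarrow> 'i \<Rightarrow> bool) \<Rightarrow> bool" where
  "directed_set A le \<longleftrightarrow> A \<noteq> {} \<and> reflp_on A le \<and> transp_on A le \<and>
     (\<forall>a\<in>A. \<forall>b\<in>A. \<exists>c\<in>A. le a c \<and> le b c)"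

definition tails :: "'i set \<Rightarrow> ('i \<Rightarrow> 'i \<Rightarrow> bool) \<Rightarrow> 'i filter" where
  "tails A le = (INF a\<in>A. principal {b\<in>A. le a b})"

text \<open>
  A definition cannot quantify over the type of the indices of a net. The quantifiers over nets
  inside the definitions below therefore range over nets with indices in the fixed type
  \<open>'a net_index\<close>, which is large enough for this to be no restriction: see the lemmas
  \<open>o_convergesI\<close>, \<open>regular_sublatticeD\<close>, \<open>order_continuous_onD\<close> and \<open>uo_LebesgueD\<close>, where the
  index type is arbitrary.
\<close>

type_synonym 'a net_index = "'a set \<times> 'a"

definition decreases_to ::
  "'a::archimedean_vector_lattice set \<Rightarrow> 'i set \<Rightarrow> ('i \<Rightarrow> 'i \<Rightarrow> bool) \<Rightarrow> ('i \<Rightarrow> 'a) \<Rightarrow> 'a \<Rightarrow> bool" where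
  "decreases_to S A le x l \<longleftrightarrow> x ` A \<subseteq> S \<and> monotone_on A le (\<ge>) x \<and> isGlb S (x ` A) l"

definition regular_sublattice :: "'a::archimedean_vector_lattice set \<Rightarrow> bool" where
  "regular_sublattice F \<longleftrightarrow> vector_sublattice F \<and>
     (\<forall>(A :: 'a net_index set) le x.
        directed_set A le \<and> decreases_to F A le x 0 \<longrightarrow> decreases_to UNIV A le x 0)"

definition o_converges ::
  "'a::archimedean_vector_lattice set \<Rightarrow> 'i set \<Rightarrow> ('i \<Rightarrow> 'i \<Rightarrow> bool) \<Rightarrow> ('i \<Rightarrow> 'a) \<Rightarrow> 'a \<Rightarrow> bool" where
  "o_converges S A le x l \<longleftrightarrow>
     (\<exists>(B :: 'a net_index set) leB y. directed_set B leB \<and> decreases_to S B leB y 0 \<and>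
        (\<forall>\<beta>\<in>B. \<exists>a\<in>A. \<forall>b\<in>A. le a b \<longrightarrow> \<bar>l - x b\<bar> \<le> y \<beta>))"

definition uo_converges ::
  "'a::archimedean_vector_lattice set \<Rightarrow> 'i set \<Rightarrow> ('i \<Rightarrow> 'i \<Rightarrow> bool) \<Rightarrow> ('i \<Rightarrow> 'a) \<Rightarrow> 'a \<Rightarrow> bool" where
  "uo_converges S A le x l \<longleftrightarrow>
     (\<forall>y\<in>S. 0 \<le> y \<longrightarrow> o_converges S A le (\<lambda>a. inf \<bar>x a - l\<bar> y) 0)"

definition linear_functional_on ::
  "'a::archimedean_vector_lattice set \<Rightarrow> ('a \<Rightarrow> real) \<Rightarrow> bool" where
  "linear_functional_on S \<phi> \<longleftrightarrow>
     (\<forall>x\<in>S. \<forall>y\<in>S. \<phi> (x + y) = \<phi> x + \<phi> y) \<and> (\<forall>c. \<forall>x\<in>S. \<phi> (c *\<^sub>R x) = c * \<phi> x)"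

definition order_continuous_on ::
  "'a::archimedean_vector_lattice set \<Rightarrow> ('a \<Rightarrow> real) \<Rightarrow> bool" where
  "order_continuous_on S \<phi> \<longleftrightarrow>
     (\<forall>(A :: 'a net_index set) le x.
        directed_set A le \<and> x ` A \<subseteq> S \<and> o_converges S A le x 0 \<longrightarrow>
        ((\<lambda>a. \<phi> (x a)) \<longlongrightarrow> 0) (tails A le))"

definition order_continuous_dual ::
  "'a::archimedean_vector_lattice set \<Rightarrow> ('a \<Rightarrow> real) set" where
  "order_continuous_dual S =
     {\<phi> \<in> extensional S. linear_functional_on S \<phi> \<and> order_continuous_on S \<phi>}"

definition separates_points :: "('a \<Rightarrow> real) set \<Rightarrow> 'a set \<Rightarrow> bool" where
  "separates_points \<Phi> S \<longleftrightarrow> (\<forall>x\<in>S. \<forall>y\<in>S. x \<noteq> y \<longrightarrow> (\<exists>\<phi>\<in>\<Phi>. \<phi> x \<noteq> \<phi> y))"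

definition linear_topology :: "'a::archimedean_vector_lattice set \<Rightarrow> 'a topology \<Rightarrow> bool" where
  "linear_topology S \<tau> \<longleftrightarrow> topspace \<tau> = S \<and>
     continuous_map (prod_topology \<tau> \<tau>) \<tau> (\<lambda>(x, y). x + y) \<and>
     continuous_map (prod_topology euclideanreal \<tau>) \<tau> (\<lambda>(c, x). c *\<^sub>R x)"

definition locally_solid :: "'a::archimedean_vector_lattice set \<Rightarrow> 'a topology \<Rightarrow> bool" where
  "locally_solid S \<tau> \<longleftrightarrow>
     (\<forall>U. openin \<tau> U \<and> 0 \<in> U \<longrightarrow>
        (\<exists>V W. solid_in S V \<and> V \<subseteq> U \<and> openin \<tau> W \<and> 0 \<in> W \<and> W \<subseteq> V))"

definition uo_Lebesgue :: "'a::archimedean_vector_lattice set \<Rightarrow> 'a topology \<Rightarrow> bool" where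
  "uo_Lebesgue S \<tau> \<longleftrightarrow> linear_topology S \<tau> \<and> locally_solid S \<tau> \<and>
     (\<forall>(A :: 'a net_index set) le x l.
        directed_set A le \<and> x ` A \<subseteq> S \<and> l \<in> S \<and> uo_converges S A le x l \<longrightarrow>
        limitin \<tau> x l (tails A le))"


lemma eventually_tails:
  assumes "directed_set A le"
  shows "eventually P (tails A le) \<longleftrightarrow> (\<exists>a\<in>A. \<forall>b\<in>A. le a b \<longrightarrow> P b)"
proof -
  have "eventually P (tails A le) \<longleftrightarrow> (\<exists>a\<in>A. eventually P (principal {b\<in>A. le a b}))"
    unfolding tails_def
  proof (rule eventually_INF_base)
    show "A \<noteq> {}"
      using assms by (simp add: directed_set_def)
    fix a b assume ab: "a \<in> A" "b \<in> A"
    then obtain c where c: "c \<in> A" "le a c" "le b c"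
      using assms by (auto simp: directed_set_def)
    have "transp_on A le"
      using assms by (simp add: directed_set_def)
    with ab c show "\<exists>c\<in>A. principal {d\<in>A. le c d} \<le>
        inf (principal {d\<in>A. le a d}) (principal {d\<in>A. le b d})"
      by (intro bexI[of _ c]) (auto dest: transp_onD)
  qed
  then show ?thesis
    by (auto simp: eventually_principal)
qed

lemma directed_set_nat: "directed_set (UNIV :: nat set) (\<le>)"
  unfolding directed_set_def by (auto simp: reflp_on_def intro: transp_onI) presburger

lemma tails_nat: "tails (UNIV :: nat set) (\<le>) = sequentially"
  by (simp add: filter_eq_iff eventually_tails[OF directed_set_nat] eventually_sequentially)

text \<open>Every net has the same tails as a net with indices in \<open>'a net_index\<close>.\<close>

lemma net_reindex:
  fixes x :: "'i \<Rightarrow> 'a"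
  assumes A: "directed_set A le"
  obtains B :: "'a net_index set" and leB y
  where "directed_set B leB" "y ` B = x ` A"
    "filtermap y (tails B leB) = filtermap x (tails A le)"
proof -
  define T where "T a = x ` {b\<in>A. le a b}" for a
  define B where "B = {(V, p). \<exists>a\<in>A. V = T a \<and> p \<in> T a}"
  define leB :: "'a net_index \<Rightarrow> 'a net_index \<Rightarrow> bool" where "leB u v \<longleftrightarrow> fst v \<subseteq> fst u" for u v
  have ne: "A \<noteq> {}" and refl: "\<And>a. a \<in> A \<Longrightarrow> le a a" and tr: "transp_on A le"
    and dir: "\<And>a b. a \<in> A \<Longrightarrow> b \<in> A \<Longrightarrow> \<exists>c\<in>A. le a c \<and> le b c"
    using A by (auto simp: directed_set_def reflp_on_def)
  have xT: "x a \<in> T a" if "a \<in> A" for a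
    using that refl by (auto simp: T_def)
  have T_mono: "T b \<subseteq> T a" if "a \<in> A" "b \<in> A" "le a b" for a b
    using that tr by (auto simp: T_def dest: transp_onD)
  have TB: "(T a, x a) \<in> B" if "a \<in> A" for a
    using that xT by (auto simp: B_def)
  have B: "directed_set B leB"
    unfolding directed_set_def
  proof (intro conjI ballI)
    show "B \<noteq> {}" using ne TB by blast
    show "reflp_on B leB" by (auto simp: reflp_on_def leB_def)
    show "transp_on B leB" by (rule transp_onI) (auto simp: leB_def)
    fix u v assume "u \<in> B" "v \<in> B"
    then obtain a b where ab: "a \<in> A" "b \<in> A" "fst u = T a" "fst v = T b"
      by (auto simp: B_def)
    then obtain c where c: "c \<in> A" "le a c" "le b c" using dir by blast
    then have "leB u (T c, x c)" "leB v (T c, x c)"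
      using ab T_mono by (auto simp: leB_def)
    with TB[OF c(1)] show "\<exists>w\<in>B. leB u w \<and> leB v w" by blast
  qed
  have im: "snd ` B = x ` A"
  proof
    show "snd ` B \<subseteq> x ` A" by (auto simp: B_def T_def)
    show "x ` A \<subseteq> snd ` B" using TB by force
  qed
  have "eventually P (filtermap snd (tails B leB)) \<longleftrightarrow> eventually P (filtermap x (tails A le))" for P
  proof -
    have "(\<exists>u\<in>B. \<forall>v\<in>B. leB u v \<longrightarrow> P (snd v)) \<longleftrightarrow> (\<exists>a\<in>A. \<forall>p\<in>T a. P p)" (is "?L \<longleftrightarrow> ?R")
    proof
      assume ?L
      then obtain u where u: "u \<in> B" "\<forall>v\<in>B. leB u v \<longrightarrow> P (snd v)" by blast
      then obtain a where a: "a \<in> A" "fst u = T a" by (auto simp: B_def)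
      have "P p" if "p \<in> T a" for p
      proof -
        have "(T a, p) \<in> B" using that a by (auto simp: B_def)
        then show ?thesis using u(2) a by (force simp: leB_def)
      qed
      with a show ?R by blast
    next
      assume ?R
      then obtain a where a: "a \<in> A" "\<forall>p\<in>T a. P p" by blast
      have "P (snd v)" if "v \<in> B" "leB (T a, x a) v" for v
        using that a by (auto simp: B_def leB_def)
      with TB[OF a(1)] show ?L by blast
    qed
    then show ?thesis
      by (auto simp: eventually_filtermap eventually_tails[OF A] eventually_tails[OF B] T_def)
  qed
  with that[OF B im] show ?thesis by (simp add: filter_eq_iff)
qed

lemma decreasing_net_reindex:
  fixes x :: "'i \<Rightarrow> 'a::archimedean_vector_lattice"
  assumes A: "directed_set A le" and x: "decreases_to S A le x l"
  obtains B :: "'a net_index set" and leB y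
  where "directed_set B leB" "y ` B = x ` A" "decreases_to S B leB y l"
proof -
  define B :: "'a net_index set" where "B = {{}} \<times> x ` A"
  define leB :: "'a net_index \<Rightarrow> 'a net_index \<Rightarrow> bool" where "leB u v \<longleftrightarrow> snd v \<le> snd u" for u v
  have im: "snd ` B = x ` A" by (force simp: B_def)
  have mono: "x b \<le> x a" if "a \<in> A" "b \<in> A" "le a b" for a b
    using x that by (auto simp: decreases_to_def monotone_on_def)
  have B: "directed_set B leB"
    unfolding directed_set_def
  proof (intro conjI ballI)
    show "B \<noteq> {}" using A by (auto simp: B_def directed_set_def)
    show "reflp_on B leB" by (auto simp: reflp_on_def leB_def)
    show "transp_on B leB" by (rule transp_onI) (auto simp: leB_def)
    fix u v assume "u \<in> B" "v \<in> B"
    then obtain a b where ab: "a \<in> A" "b \<in> A" "snd u = x a" "snd v = x b"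
      by (auto simp: B_def)
    then obtain c where c: "c \<in> A" "le a c" "le b c"
      using A by (auto simp: directed_set_def)
    then show "\<exists>w\<in>B. leB u w \<and> leB v w"
      using ab mono by (intro bexI[of _ "({}, x c)"]) (auto simp: B_def leB_def)
  qed
  have "decreases_to S B leB snd l"
    using x im by (auto simp: decreases_to_def monotone_on_def leB_def)
  with that B im show ?thesis by blast
qed

lemma o_convergesI:
  fixes B :: "'k set" and S :: "'a::archimedean_vector_lattice set"
  assumes B: "directed_set B leB" "decreases_to S B leB y 0"
    and le: "\<And>\<beta>. \<beta> \<in> B \<Longrightarrow> \<exists>a\<in>A. \<forall>b\<in>A. le a b \<longrightarrow> \<bar>l - x b\<bar> \<le> y \<beta>"
  shows "o_converges S A le x l"
proof -
  obtain B' :: "'a net_index set" and leB' y'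
    where *: "directed_set B' leB'" "y' ` B' = y ` B" "decreases_to S B' leB' y' 0"
    using decreasing_net_reindex[OF B] by blast
  have "\<exists>a\<in>A. \<forall>b\<in>A. le a b \<longrightarrow> \<bar>l - x b\<bar> \<le> y' \<beta>" if "\<beta> \<in> B'" for \<beta>
  proof -
    have "y' \<beta> \<in> y ` B" using that *(2) by blast
    then show ?thesis using le by fastforce
  qed
  with * show ?thesis unfolding o_converges_def by blast
qed

lemma regular_sublatticeD:
  fixes A :: "'i set" and F :: "'a::archimedean_vector_lattice set"
  assumes F: "regular_sublattice F" and A: "directed_set A le" and x: "decreases_to F A le x 0"
  shows "decreases_to UNIV A le x 0"
proof -
  obtain B :: "'a net_index set" and leB y
    where *: "directed_set B leB" "y ` B = x ` A" "decreases_to F B leB y 0"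
    using decreasing_net_reindex[OF A x] by blast
  then have "decreases_to UNIV B leB y 0"
    using F by (auto simp: regular_sublattice_def)
  with * x show ?thesis by (simp add: decreases_to_def)
qed

lemma o_converges_filtermap:
  fixes S :: "'a::archimedean_vector_lattice set"
  assumes A: "directed_set A le" and B: "directed_set B leB"
    and eq: "filtermap x (tails A le) = filtermap y (tails B leB)"
    and conv: "o_converges S A le (\<lambda>a. f (x a)) l"
  shows "o_converges S B leB (\<lambda>b. f (y b)) l"
proof -
  have "(\<exists>a\<in>A. \<forall>b\<in>A. le a b \<longrightarrow> P (x b)) \<longleftrightarrow> (\<exists>a\<in>B. \<forall>b\<in>B. leB a b \<longrightarrow> P (y b))" for P
    using eq unfolding filter_eq_iff eventually_filtermap eventually_tails[OF A] eventually_tails[OF B]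
    by blast
  from this[of "\<lambda>v. \<bar>l - f v\<bar> \<le> _"] conv show ?thesis
    unfolding o_converges_def by simp
qed

lemma order_continuous_onD:
  fixes A :: "'i set" and S :: "'a::archimedean_vector_lattice set"
  assumes \<phi>: "order_continuous_on S \<phi>"
    and A: "directed_set A le" and x: "x ` A \<subseteq> S" "o_converges S A le x 0"
  shows "((\<lambda>a. \<phi> (x a)) \<longlongrightarrow> 0) (tails A le)"
proof -
  obtain B :: "'a net_index set" and leB y
    where *: "directed_set B leB" "y ` B = x ` A"
      "filtermap y (tails B leB) = filtermap x (tails A le)"
    using net_reindex[OF A] by blast
  have "o_converges S B leB y 0"
    using o_converges_filtermap[OF A *(1) *(3)[symmetric], of S "\<lambda>v. v"] x by simp
  then have "((\<lambda>b. \<phi> (y b)) \<longlongrightarrow> 0) (tails B leB)"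
    using \<phi> * x by (auto simp: order_continuous_on_def)
  then have "(\<phi> \<longlongrightarrow> 0) (filtermap x (tails A le))"
    by (simp add: filterlim_filtermap flip: *(3))
  then show ?thesis by (simp add: filterlim_filtermap)
qed

lemma uo_LebesgueD:
  fixes A :: "'i set" and S :: "'a::archimedean_vector_lattice set"
  assumes \<tau>: "uo_Lebesgue S \<tau>"
    and A: "directed_set A le" and x: "x ` A \<subseteq> S" "l \<in> S" "uo_converges S A le x l"
  shows "limitin \<tau> x l (tails A le)"
proof -
  obtain B :: "'a net_index set" and leB y
    where *: "directed_set B leB" "y ` B = x ` A"
      "filtermap y (tails B leB) = filtermap x (tails A le)"
    using net_reindex[OF A] by blast
  have "uo_converges S B leB y l"
    using o_converges_filtermap[OF A *(1) *(3)[symmetric], of S "\<lambda>v. inf \<bar>v - l\<bar> _"] x(3)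
    by (simp add: uo_converges_def)
  then have "limitin \<tau> y l (tails B leB)"
    using \<tau> * x by (auto simp: uo_Lebesgue_def)
  moreover have "eventually (\<lambda>b. y b \<in> U) (tails B leB) \<longleftrightarrow> eventually (\<lambda>a. x a \<in> U) (tails A le)" for U
    using arg_cong[OF *(3), of "eventually (\<lambda>v. v \<in> U)"] by (simp add: eventually_filtermap)
  ultimately show ?thesis
    by (simp add: limitin_def)
qed

end

theory Submission
  imports Defs
begin

text \<open>
  For an order continuous functional \<open>\<phi>\<close> on \<open>F\<close> let \<open>p\<close> be the seminorm \<open>x \<mapsto> |\<phi>|(|x|)\<close> on \<open>F\<close>. The
  pseudonorms \<open>x \<mapsto> p(|x| \<and> f)\<close>, \<open>0 \<le> f \<in> F\<close>, make sense on all of \<open>E\<close> and define the topology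
  on \<open>G\<close>.

  For the selection of a sequence, let \<open>\<tau>\<close> be any Hausdorff uo-Lebesgue topology on \<open>G\<close>. By the
  countable sup property, countably many zero neighbourhoods suffice to separate the points of a
  given order interval \<open>[0, f]\<close>. If each new index is chosen far enough out with respect to the
  neighbourhoods belonging to the intervals \<open>[0, |x - l|]\<close> of all earlier terms \<open>x\<close>, then the
  chosen sequence is uo-convergent by a Borel-Cantelli argument. Uniqueness of \<open>\<tau>\<close> follows: a set
  that is open for one such topology but not for another would be avoided by a sequence that
  uo-converges to one of its points.
\<close>

section \<open>Downward directed sets with infimum zero\<close>

text \<open>No completeness is available, so suprema and upper limits need not exist. That
  \<open>f\<close> is the supremum of \<open>Q\<close> therefore appears as \<open>f - Q\<close>
  being directed downward with infimum zero, and an upper limit is replaced by the set of eventual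
  upper bounds. Such infima are computed with the Archimedean property: an element that can be
  subtracted for ever without leaving a set bounded below must vanish.

  The topology need not be first countable. In place of a countable base, a sequence of solid zero
  neighbourhoods with \<open>V (n+1) + V (n+1)\<close> inside \<open>V n\<close> does the work of a
  single pseudonorm. Its kernel may be nonzero; that some such sequence has trivial kernel below a
  given \<open>f\<close> requires the Hausdorff property, order continuity of the topology and the
  countable sup property together.

  For existence, the obstacle is that uo-convergence in \<open>G\<close> is tested only against
  elements of \<open>G\<close>, while the pseudonorms are truncated at elements of \<open>F\<close>.
  Regularity carries sets decreasing to zero from \<open>G\<close> to \<open>E\<close>, and
  truncation at \<open>f\<close> carries them on to \<open>F\<close>.\<close>

lemma inf_add_le:
  fixes u a b :: "'a::archimedean_vector_lattice"
  assumes "0 \<le> u" "0 \<le> a" "0 \<le> b"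
  shows "inf u (a + b) \<le> inf u a + inf u b"
proof -
  let ?t = "inf u (a + b)"
  \<comment> \<open>The two bounds on \<open>?t\<close> share the summand \<open>inf u b\<close>, so
    their infimum is \<open>inf u b + inf u a\<close>.\<close>
  have 1: "?t \<le> inf u b + u"
    using assms by (metis add_increasing inf.cobounded1 le_infI order_trans)
  have "?t \<le> u + a" "?t \<le> b + a"
    using assms by (simp_all add: add.commute add_increasing2 le_infI1)
  then have 2: "?t \<le> inf u b + a"
    by (simp add: add_inf_distrib_right)
  from 1 2 have "?t \<le> inf (inf u b + u) (inf u b + a)" by simp
  then show ?thesis by (metis add_inf_distrib_left add.commute)
qed

lemma sup_le_add:
  fixes p q :: "'a::archimedean_vector_lattice"
  shows "0 \<le> p \<Longrightarrow> 0 \<le> q \<Longrightarrow> sup p q \<le> p + q"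
  by (simp add: add_increasing add_increasing2)

lemma abs_scaleR_le:
  fixes x :: "'a::archimedean_vector_lattice"
  shows "\<bar>c *\<^sub>R x\<bar> \<le> \<bar>c\<bar> *\<^sub>R \<bar>x\<bar>"
proof (rule abs_leI)
  show "c *\<^sub>R x \<le> \<bar>c\<bar> *\<^sub>R \<bar>x\<bar>"
  proof (cases "0 \<le> c")
    case False
    then have "c *\<^sub>R x = \<bar>c\<bar> *\<^sub>R (- x)" by simp
    also have "\<dots> \<le> \<bar>c\<bar> *\<^sub>R \<bar>x\<bar>" by (intro scaleR_left_mono) (simp_all add: abs_ge_minus_self)
    finally show ?thesis .
  qed (simp add: scaleR_left_mono abs_ge_self)
  show "- (c *\<^sub>R x) \<le> \<bar>c\<bar> *\<^sub>R \<bar>x\<bar>"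
  proof (cases "0 \<le> c")
    case True
    then have "- (c *\<^sub>R x) = \<bar>c\<bar> *\<^sub>R (- x)" by simp
    also have "\<dots> \<le> \<bar>c\<bar> *\<^sub>R \<bar>x\<bar>" by (intro scaleR_left_mono) (simp_all add: abs_ge_minus_self)
    finally show ?thesis .
  next
    case False
    then have "- (c *\<^sub>R x) = \<bar>c\<bar> *\<^sub>R x" by simp
    also have "\<dots> \<le> \<bar>c\<bar> *\<^sub>R \<bar>x\<bar>" by (intro scaleR_left_mono) (simp_all add: abs_ge_self)
    finally show ?thesis .
  qed
qed

lemma abs_scaleR_eq:
  fixes x :: "'a::archimedean_vector_lattice"
  shows "\<bar>c *\<^sub>R x\<bar> = \<bar>c\<bar> *\<^sub>R \<bar>x\<bar>"
proof (cases "c = 0")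
  case False
  have "\<bar>x\<bar> \<le> \<bar>inverse c\<bar> *\<^sub>R \<bar>c *\<^sub>R x\<bar>"
    using abs_scaleR_le[of "inverse c" "c *\<^sub>R x"] False by simp
  from scaleR_left_mono[OF this, of "\<bar>c\<bar>"]
  have "\<bar>c\<bar> *\<^sub>R \<bar>x\<bar> \<le> \<bar>c *\<^sub>R x\<bar>" using False by (simp flip: abs_mult)
  with abs_scaleR_le show ?thesis by (rule order_antisym)
qed simp

text \<open>By induction all \<open>a + n w\<close> stay in \<open>Q\<close>, so \<open>n w\<close>
  is at most \<open>b - a\<close> for every \<open>n\<close>. In the applications \<open>w\<close>
  is a common lower bound of differences, and that is what makes \<open>Q\<close> invariant.\<close>

lemma zero_if_translation_invariant_bounded:
  fixes w :: "'a::archimedean_vector_lattice"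
  assumes w: "0 \<le> w" and a: "a \<in> Q" and step: "\<And>q. q \<in> Q \<Longrightarrow> q + w \<in> Q"
    and bound: "\<And>q. q \<in> Q \<Longrightarrow> q \<le> b"
  shows "w = 0"
proof -
  have Q: "a + real n *\<^sub>R w \<in> Q" for n
  proof (induction n)
    case (Suc n)
    have "a + real (Suc n) *\<^sub>R w = (a + real n *\<^sub>R w) + w"
      by (simp add: scaleR_add_left add_ac)
    with step[OF Suc] show ?case by metis
  qed (use a in simp)
  have "real n *\<^sub>R w \<le> b - a" for n
    using bound[OF Q[of n]] by (simp add: le_diff_eq add.commute)
  with w show ?thesis by (rule archimedean)
qed

lemma zero_if_translation_invariant_bounded_below:
  fixes w :: "'a::archimedean_vector_lattice"
  assumes w: "0 \<le> w" and a: "a \<in> Q" and step: "\<And>q. q \<in> Q \<Longrightarrow> q - w \<in> Q"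
    and bound: "\<And>q. q \<in> Q \<Longrightarrow> b \<le> q"
  shows "w = 0"
proof (rule zero_if_translation_invariant_bounded[OF w])
  show "- a \<in> uminus ` Q" using a by simp
  show "q + w \<in> uminus ` Q" if "q \<in> uminus ` Q" for q
  proof -
    have "- q \<in> Q" using that by auto
    then have "- q - w \<in> Q" by (rule step)
    then show ?thesis by (intro image_eqI[of _ _ "- q - w"]) auto
  qed
  show "q \<le> - b" if "q \<in> uminus ` Q" for q
    using that bound by auto
qed

lemma vector_sublattice_mem:
  assumes "vector_sublattice S"
  shows "0 \<in> S" and "x \<in> S \<Longrightarrow> y \<in> S \<Longrightarrow> x + y \<in> S" and "x \<in> S \<Longrightarrow> y \<in> S \<Longrightarrow> x - y \<in> S"
    and "x \<in> S \<Longrightarrow> - x \<in> S" and "x \<in> S \<Longrightarrow> c *\<^sub>R x \<in> S"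
    and "x \<in> S \<Longrightarrow> y \<in> S \<Longrightarrow> sup x y \<in> S" and "x \<in> S \<Longrightarrow> y \<in> S \<Longrightarrow> inf x y \<in> S"
    and "x \<in> S \<Longrightarrow> \<bar>x\<bar> \<in> S"
  using assms by (auto simp: vector_sublattice_def abs_lattice subspace_0 subspace_add subspace_diff
      subspace_neg subspace_scale)

lemma order_ideal_imp_vector_sublattice:
  assumes "order_ideal F"
  shows "vector_sublattice F"
  unfolding vector_sublattice_def
proof (intro conjI ballI)
  show sub: "subspace F" using assms by (simp add: order_ideal_def)
  fix x y assume xy: "x \<in> F" "y \<in> F"
  have sol: "\<And>v w. v \<in> F \<Longrightarrow> \<bar>w\<bar> \<le> \<bar>v\<bar> \<Longrightarrow> w \<in> F"
    using assms by (auto simp: order_ideal_def solid_in_def)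
  have "\<bar>x\<bar> \<in> F" "\<bar>y\<bar> \<in> F" using xy sol by (metis abs_idempotent order_refl)+
  then have s: "\<bar>x\<bar> + \<bar>y\<bar> \<in> F" using sub by (simp add: subspace_add)
  have nn: "\<bar>\<bar>x\<bar> + \<bar>y\<bar>\<bar> = \<bar>x\<bar> + \<bar>y\<bar>" by simp
  have x: "x \<le> \<bar>x\<bar> + \<bar>y\<bar>" "- x \<le> \<bar>x\<bar> + \<bar>y\<bar>"
    by (metis abs_ge_self abs_ge_minus_self abs_ge_zero add_increasing2)+
  have y: "y \<le> \<bar>x\<bar> + \<bar>y\<bar>" "- y \<le> \<bar>x\<bar> + \<bar>y\<bar>"
    by (metis abs_ge_self abs_ge_minus_self abs_ge_zero add_increasing)+
  have "\<bar>sup x y\<bar> \<le> \<bar>x\<bar> + \<bar>y\<bar>"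
    by (rule abs_leI) (use x y in \<open>auto simp: neg_sup_eq_inf intro: le_infI1\<close>)
  then show "sup x y \<in> F" using sol[OF s] nn by simp
  have "\<bar>inf x y\<bar> \<le> \<bar>x\<bar> + \<bar>y\<bar>"
    by (rule abs_leI) (use x y in \<open>auto simp: neg_inf_eq_sup intro: le_infI1\<close>)
  then show "inf x y \<in> F" using sol[OF s] nn by simp
qed

text \<open>A set indexed by itself under \<open>\<ge>\<close> replaces a net decreasing to zero.
  Order convergence sees only the range of the dominating net, so nothing is lost and index types
  disappear.\<close>

definition downward_null :: "'a::archimedean_vector_lattice set \<Rightarrow> 'a set \<Rightarrow> bool" where
  "downward_null S D \<longleftrightarrow> D \<subseteq> S \<and> D \<noteq> {} \<and> 0 \<in> S \<and> (\<forall>a\<in>D. \<forall>b\<in>D. \<exists>c\<in>D. c \<le> a \<and> c \<le> b) \<and>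
     (\<forall>d\<in>D. 0 \<le> d) \<and> (\<forall>z\<in>S. (\<forall>d\<in>D. z \<le> d) \<longrightarrow> z \<le> 0)"

text \<open>A lower bound \<open>z\<close> may be replaced by \<open>sup z 0\<close>, again a lower
  bound because \<open>D\<close> is nonnegative; hence only nonnegative ones need testing.\<close>

lemma downward_nullI:
  assumes S: "vector_sublattice S" and "D \<subseteq> S" "D \<noteq> {}"
    and "\<And>a b. a \<in> D \<Longrightarrow> b \<in> D \<Longrightarrow> \<exists>c\<in>D. c \<le> a \<and> c \<le> b"
    and pos: "\<And>d. d \<in> D \<Longrightarrow> 0 \<le> d"
    and null: "\<And>z. z \<in> S \<Longrightarrow> 0 \<le> z \<Longrightarrow> (\<And>d. d \<in> D \<Longrightarrow> z \<le> d) \<Longrightarrow> z = 0"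
  shows "downward_null S D"
  unfolding downward_null_def
proof (intro conjI ballI impI)
  fix z assume "z \<in> S" "\<forall>d\<in>D. z \<le> d"
  then have "sup z 0 = 0"
    using null[of "sup z 0"] pos vector_sublattice_mem[OF S] by auto
  then show "z \<le> 0" by (metis sup_ge1)
qed (use assms vector_sublattice_mem[OF S] in auto)

lemma isGlb_zero_iff:
  "isGlb S D 0 \<longleftrightarrow> 0 \<in> S \<and> (\<forall>d\<in>D. 0 \<le> d) \<and> (\<forall>z\<in>S. (\<forall>d\<in>D. z \<le> d) \<longrightarrow> z \<le> 0)"
  unfolding isGlb_def greatestP_def isLb_def setge_def setle_def by auto

lemma downward_null_net:
  assumes "downward_null S D"
  shows "directed_set D (\<ge>)" and "decreases_to S D (\<ge>) (\<lambda>d. d) 0"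
  using assms
  by (auto simp: downward_null_def directed_set_def decreases_to_def isGlb_zero_iff
      monotone_on_def intro!: reflp_onI transp_onI)

lemma net_downward_null:
  assumes A: "directed_set A le" and x: "decreases_to S A le x 0"
  shows "downward_null S (x ` A)"
  unfolding downward_null_def
proof (intro conjI)
  show "\<forall>a\<in>x ` A. \<forall>b\<in>x ` A. \<exists>c\<in>x ` A. c \<le> a \<and> c \<le> b"
  proof (intro ballI)
    fix p q assume "p \<in> x ` A" "q \<in> x ` A"
    then obtain a b where ab: "a \<in> A" "b \<in> A" "p = x a" "q = x b" by blast
    then obtain c where "c \<in> A" "le a c" "le b c"
      using A by (auto simp: directed_set_def)
    then show "\<exists>c\<in>x ` A. c \<le> p \<and> c \<le> q"
      using x ab by (intro bexI[of _ "x c"]) (auto simp: decreases_to_def monotone_on_def)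
  qed
qed (use assms in \<open>auto simp: directed_set_def decreases_to_def isGlb_zero_iff\<close>)

text \<open>Forwards, \<open>D\<close> is the range of the dominating net; backwards,
  \<open>D\<close> serves as its own index set.\<close>

lemma o_converges_zero_iff:
  fixes S :: "'a::archimedean_vector_lattice set"
  assumes A: "directed_set A le"
  shows "o_converges S A le x 0 \<longleftrightarrow>
    (\<exists>D. downward_null S D \<and> (\<forall>d\<in>D. eventually (\<lambda>a. \<bar>x a\<bar> \<le> d) (tails A le)))"
proof
  assume "o_converges S A le x 0"
  then obtain B :: "'a net_index set" and leB y where
    "directed_set B leB" "decreases_to S B leB y 0"
    and le: "\<forall>\<beta>\<in>B. \<exists>a\<in>A. \<forall>b\<in>A. le a b \<longrightarrow> \<bar>0 - x b\<bar> \<le> y \<beta>"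
    unfolding o_converges_def by blast
  then show "\<exists>D. downward_null S D \<and> (\<forall>d\<in>D. eventually (\<lambda>a. \<bar>x a\<bar> \<le> d) (tails A le))"
    by (intro exI[of _ "y ` B"]) (auto simp: eventually_tails[OF A] intro: net_downward_null)
next
  assume "\<exists>D. downward_null S D \<and> (\<forall>d\<in>D. eventually (\<lambda>a. \<bar>x a\<bar> \<le> d) (tails A le))"
  then obtain D where D: "downward_null S D"
    and ev: "\<forall>d\<in>D. eventually (\<lambda>a. \<bar>x a\<bar> \<le> d) (tails A le)" by blast
  show "o_converges S A le x 0"
    by (rule o_convergesI[OF downward_null_net[OF D]])
      (use ev in \<open>simp add: eventually_tails[OF A]\<close>)
qed

lemma uo_converges_iff:
  assumes S: "directed_set A le"
  shows "uo_converges S A le x l \<longleftrightarrow>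
    (\<forall>y\<in>S. 0 \<le> y \<longrightarrow> (\<exists>D. downward_null S D \<and>
      (\<forall>d\<in>D. eventually (\<lambda>a. inf \<bar>x a - l\<bar> y \<le> d) (tails A le))))"
proof -
  have "\<bar>inf \<bar>x a - l\<bar> y\<bar> = inf \<bar>x a - l\<bar> y" if "0 \<le> y" for a y
    using that by simp
  then show ?thesis
    by (simp add: uo_converges_def o_converges_zero_iff[OF S] cong: imp_cong)
qed

text \<open>
  A positive lower bound \<open>z\<close> of \<open>f - Q\<close> dominates some \<open>0 < d \<in> Q\<close>, and then \<open>d\<close> can be
  added to elements of \<open>Q\<close> for ever.
\<close>

lemma downward_null_exhaustion:
  assumes S: "vector_sublattice S" and f: "f \<in> S" and Q: "Q \<subseteq> S" "0 \<in> Q"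
    and bounds: "\<And>q. q \<in> Q \<Longrightarrow> 0 \<le> q \<and> q \<le> f"
    and add: "\<And>p q. p \<in> Q \<Longrightarrow> q \<in> Q \<Longrightarrow> p + q \<le> f \<Longrightarrow> p + q \<in> Q"
    and up: "\<And>p q. p \<in> Q \<Longrightarrow> q \<in> Q \<Longrightarrow> sup p q \<in> Q"
    and dense: "\<And>z. z \<in> S \<Longrightarrow> 0 < z \<Longrightarrow> z \<le> f \<Longrightarrow> \<exists>d\<in>Q. 0 < d \<and> d \<le> z"
  shows "downward_null S ((\<lambda>q. f - q) ` Q)"
proof (rule downward_nullI[OF S])
  show "(\<lambda>q. f - q) ` Q \<subseteq> S"
    using Q f vector_sublattice_mem[OF S] by blast
  show "(\<lambda>q. f - q) ` Q \<noteq> {}" using Q by blast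
  show "\<exists>c\<in>(\<lambda>q. f - q) ` Q. c \<le> a \<and> c \<le> b"
    if ab: "a \<in> (\<lambda>q. f - q) ` Q" "b \<in> (\<lambda>q. f - q) ` Q" for a b
  proof -
    from ab obtain p q where pq: "p \<in> Q" "q \<in> Q" "a = f - p" "b = f - q" by blast
    have "f - sup p q \<in> (\<lambda>q. f - q) ` Q" using up[OF pq(1,2)] by (rule imageI)
    moreover have "f - sup p q \<le> a" "f - sup p q \<le> b"
      unfolding pq by (intro diff_left_mono; simp)+
    ultimately show ?thesis by blast
  qed
  show "0 \<le> d" if "d \<in> (\<lambda>q. f - q) ` Q" for d
    using that bounds by auto
  fix z assume z: "z \<in> S" "0 \<le> z" and le: "\<And>d. d \<in> (\<lambda>q. f - q) ` Q \<Longrightarrow> z \<le> d"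
  show "z = 0"
  proof (rule ccontr)
    assume "z \<noteq> 0"
    moreover have "z \<le> f" using le Q by force
    ultimately obtain d where d: "d \<in> Q" "0 < d" "d \<le> z"
      using dense[of z] z by fastforce
    have "d = 0"
    proof (rule zero_if_translation_invariant_bounded[of d 0 Q f])
      fix q assume q: "q \<in> Q"
      then have "d \<le> f - q" using le d by (meson image_eqI order_trans)
      then have "q + d \<le> f" by (simp add: le_diff_eq add.commute)
      with q d show "q + d \<in> Q" by (intro add)
    qed (use d Q bounds in auto)
    with d show False by simp
  qed
qed

lemma regular_downward_null:
  assumes "regular_sublattice G" and D: "downward_null G D"
  shows "downward_null UNIV D"
proof -
  have "decreases_to UNIV D (\<ge>) (\<lambda>d. d) 0"
    using assms(1) downward_null_net[OF D] by (rule regular_sublatticeD)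
  with net_downward_null[OF downward_null_net(1)[OF D] this] show ?thesis
    by simp
qed

text \<open>By regularity \<open>D\<close> has infimum zero in the whole space too, where the
  countable sup property applies to \<open>- D\<close>. A countable subset with infimum zero there
  has no positive lower bound in \<open>G\<close> either.\<close>

lemma regular_countable_glb:
  fixes G D :: "'a::archimedean_vector_lattice set"
  assumes csp: "countable_sup_property (UNIV :: 'a set)" and G: "regular_sublattice G"
    and D: "downward_null G D"
  shows "\<exists>C\<subseteq>D. countable C \<and> (\<forall>z\<in>G. (\<forall>d\<in>C. z \<le> d) \<longrightarrow> z \<le> 0)"
proof -
  have D': "downward_null UNIV D" using G D by (rule regular_downward_null)
  have "isLub UNIV (uminus ` D) 0"
    unfolding isLub_def leastP_def isUb_def setge_def setle_def
  proof (intro conjI CollectI ballI)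
    fix z assume "z \<in> {x. (\<forall>y\<in>uminus ` D. y \<le> x) \<and> x \<in> UNIV}"
    then have "\<forall>d\<in>D. - z \<le> d" by (auto simp: minus_le_iff)
    with D' have "- z \<le> 0" by (auto simp: downward_null_def)
    then show "0 \<le> z" by simp
  qed (use D' in \<open>auto simp: downward_null_def\<close>)
  moreover have "uminus ` D \<noteq> {}" using D by (auto simp: downward_null_def)
  ultimately obtain C where C: "C \<subseteq> uminus ` D" "countable C" "isLub UNIV C 0"
    using csp unfolding countable_sup_property_def by (metis subset_UNIV)
  have "z \<le> 0" if "\<forall>d\<in>uminus ` C. z \<le> d" for z
  proof -
    have "\<forall>c\<in>C. c \<le> - z" using that by (auto simp: le_minus_iff)
    with C(3) have "0 \<le> - z"
      by (auto simp: isLub_def leastP_def isUb_def setge_def setle_def)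
    then show ?thesis by simp
  qed
  moreover have "uminus ` C \<subseteq> D" using C(1) by auto
  ultimately show ?thesis using C(2) by blast
qed

section \<open>Uo-convergent sequences in a Hausdorff uo-Lebesgue topology\<close>

text \<open>The countable sup property enters only as \<open>countable_glb\<close>, a condition on
  \<open>S\<close> alone, so the arguments below never leave \<open>S\<close>.\<close>

locale hausdorff_uo_Lebesgue =
  fixes S :: "'a::archimedean_vector_lattice set" and \<tau> :: "'a topology"
  assumes S: "vector_sublattice S" and hausdorff: "Hausdorff_space \<tau>"
    and uo_Lebesgue: "uo_Lebesgue S \<tau>"
    and countable_glb:
      "downward_null S D \<Longrightarrow> \<exists>C\<subseteq>D. countable C \<and> (\<forall>z\<in>S. (\<forall>d\<in>C. z \<le> d) \<longrightarrow> z \<le> 0)"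
begin

lemmas mem = vector_sublattice_mem[OF S]

section \<open>Normal sequences of solid zero neighbourhoods\<close>

definition zero_nbhd :: "'a set \<Rightarrow> bool" where
  "zero_nbhd V \<longleftrightarrow> (\<exists>W. openin \<tau> W \<and> 0 \<in> W \<and> W \<subseteq> V)"

text \<open>As in the metrization of topological groups, \<open>Q n\<close> behaves like a ball of
  radius \<open>2^(-n)\<close> for a solid pseudonorm, which is never constructed.\<close>

definition normal_seq :: "(nat \<Rightarrow> 'a set) \<Rightarrow> bool" where
  "normal_seq Q \<longleftrightarrow> (\<forall>n. solid_in S (Q n) \<and> zero_nbhd (Q n) \<and>
     (\<forall>a\<in>Q (Suc n). \<forall>b\<in>Q (Suc n). a + b \<in> Q n))"

text \<open>The intersection of all \<open>Q n\<close> plays the role of the kernel of a pseudonorm;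
  below \<open>f\<close> it is required to vanish.\<close>

definition trivial_on :: "(nat \<Rightarrow> 'a set) \<Rightarrow> 'a \<Rightarrow> bool" where
  "trivial_on Q f \<longleftrightarrow> (\<forall>w\<in>S. 0 \<le> w \<and> w \<le> f \<and> (\<forall>n. w \<in> Q n) \<longrightarrow> w = 0)"

lemma topspace: "topspace \<tau> = S"
  and continuous_add: "continuous_map (prod_topology \<tau> \<tau>) \<tau> (\<lambda>(x, y). x + y)"
  and locally_solid: "locally_solid S \<tau>"
  using uo_Lebesgue by (simp_all add: uo_Lebesgue_def linear_topology_def)

lemma solid_mem: "solid_in S V \<Longrightarrow> v \<in> V \<Longrightarrow> x \<in> S \<Longrightarrow> 0 \<le> x \<Longrightarrow> x \<le> v \<Longrightarrow> x \<in> V"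
  unfolding solid_in_def by (metis abs_of_nonneg order_trans)

lemma zero_nbhd_zero: "zero_nbhd U \<Longrightarrow> 0 \<in> U"
  unfolding zero_nbhd_def by blast

lemma zero_nbhd_Int: "zero_nbhd U \<Longrightarrow> zero_nbhd V \<Longrightarrow> zero_nbhd (U \<inter> V)"
  unfolding zero_nbhd_def by (metis Int_iff Int_mono openin_Int)

lemma zero_nbhd_space: "zero_nbhd S"
  unfolding zero_nbhd_def using topspace mem(1) openin_topspace by blast

lemma zero_nbhd_INT:
  "(\<And>i. i \<le> n \<Longrightarrow> zero_nbhd (P i)) \<Longrightarrow> zero_nbhd (\<Inter>i\<le>n. P i)" for n :: nat
  by (induction n) (simp_all add: atMost_Suc zero_nbhd_Int)

text \<open>Continuity of addition at \<open>(0, 0)\<close> gives a product neighbourhood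
  \<open>A \<times> B\<close>; a solid set inside \<open>A \<inter> B \<inter> W\<close> then
  satisfies the sum condition and lies in \<open>U\<close>.\<close>

lemma zero_nbhd_half:
  assumes "zero_nbhd U"
  shows "\<exists>V. solid_in S V \<and> zero_nbhd V \<and> V \<subseteq> U \<and> (\<forall>a\<in>V. \<forall>b\<in>V. a + b \<in> U)"
proof -
  obtain W where W: "openin \<tau> W" "0 \<in> W" "W \<subseteq> U"
    using assms by (auto simp: zero_nbhd_def)
  let ?P = "{p \<in> topspace (prod_topology \<tau> \<tau>). (case p of (x, y) \<Rightarrow> x + y) \<in> W}"
  have "openin (prod_topology \<tau> \<tau>) ?P"
    using continuous_add W(1) by (rule openin_continuous_map_preimage)
  moreover have "(0, 0) \<in> ?P"
    using W mem(1) topspace by auto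
  ultimately obtain A B where AB: "openin \<tau> A" "openin \<tau> B" "0 \<in> A" "0 \<in> B" "A \<times> B \<subseteq> ?P"
    unfolding openin_prod_topology_alt by meson
  then have "openin \<tau> (A \<inter> B \<inter> W)" "0 \<in> A \<inter> B \<inter> W"
    using W by auto
  then obtain V W' where V: "solid_in S V" "V \<subseteq> A \<inter> B \<inter> W" "openin \<tau> W'" "0 \<in> W'" "W' \<subseteq> V"
    using locally_solid unfolding locally_solid_def by meson
  have "a + b \<in> U" if "a \<in> V" "b \<in> V" for a b
  proof -
    have "(a, b) \<in> A \<times> B" using that V(2) by blast
    then have "(a, b) \<in> ?P" using AB(5) by blast
    then show ?thesis using W(3) by auto
  qed
  moreover have "zero_nbhd V" using V by (auto simp: zero_nbhd_def)
  ultimately show ?thesis using V W by blast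
qed

lemma normal_seq_exists:
  assumes "zero_nbhd U"
  obtains Q where "normal_seq Q" "Q 0 \<subseteq> U"
proof -
  let ?P = "\<lambda>n V. solid_in S V \<and> zero_nbhd V \<and> (n = 0 \<longrightarrow> V \<subseteq> U)"
  have "\<exists>Q. \<forall>n::nat. ?P n (Q n) \<and> (\<forall>a\<in>Q (Suc n). \<forall>b\<in>Q (Suc n). a + b \<in> Q n)"
  proof (rule dependent_nat_choice)
    show "\<exists>V. ?P 0 V" using zero_nbhd_half[OF assms] by blast
    show "\<exists>V'. ?P (Suc n) V' \<and> (\<forall>a\<in>V'. \<forall>b\<in>V'. a + b \<in> V)" if "?P n V" for V n
      using zero_nbhd_half[of V] that by blast
  qed
  then show thesis using that unfolding normal_seq_def by blast
qed

lemma normal_seqD: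
  assumes "normal_seq Q"
  shows "solid_in S (Q n)" "zero_nbhd (Q n)" "0 \<in> Q n"
    "a \<in> Q (Suc n) \<Longrightarrow> b \<in> Q (Suc n) \<Longrightarrow> a + b \<in> Q n"
  using assms by (auto simp: normal_seq_def intro: zero_nbhd_zero)

lemma normal_seq_antimono:
  assumes "normal_seq Q" "m \<le> n"
  shows "Q n \<subseteq> Q m"
proof (rule lift_Suc_antimono_le[OF _ assms(2)])
  show "Q (Suc n) \<subseteq> Q n" for n
    using normal_seqD(4)[OF assms(1) _ normal_seqD(3)[OF assms(1)]] by auto
qed

lemma normal_seq_Int:
  "normal_seq P \<Longrightarrow> normal_seq Q \<Longrightarrow> normal_seq (\<lambda>n. P n \<inter> Q n)"
  unfolding normal_seq_def by (auto simp: zero_nbhd_Int solid_in_def)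

lemma normal_seq_shift: "normal_seq Q \<Longrightarrow> normal_seq (\<lambda>n. Q (Suc n))"
  unfolding normal_seq_def by auto

text \<open>Each set is a finite intersection and so still a zero neighbourhood, and enlarging the
  range of \<open>i\<close> from \<open>n\<close> to \<open>n + 1\<close> only helps the sum
  condition. This merges countably many normal sequences into one.\<close>

lemma normal_seq_diagonal:
  assumes "\<And>i. normal_seq (P i)"
  shows "normal_seq (\<lambda>n. \<Inter>i\<le>n. P i n)"
  unfolding normal_seq_def
proof (intro allI conjI ballI)
  fix n
  show "solid_in S (\<Inter>i\<le>n. P i n)"
    unfolding solid_in_def
  proof (intro conjI ballI impI)
    show "(\<Inter>i\<le>n. P i n) \<subseteq> S"
      using normal_seqD(1)[OF assms, of 0 n] by (auto simp: solid_in_def)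
    fix v x assume "v \<in> (\<Inter>i\<le>n. P i n)" "x \<in> S" "\<bar>x\<bar> \<le> \<bar>v\<bar>"
    then show "x \<in> (\<Inter>i\<le>n. P i n)"
      using normal_seqD(1)[OF assms] unfolding solid_in_def by (metis INT_iff)
  qed
  show "zero_nbhd (\<Inter>i\<le>n. P i n)"
    using normal_seqD(2)[OF assms] by (intro zero_nbhd_INT)
  fix a b assume "a \<in> (\<Inter>i\<le>Suc n. P i (Suc n))" "b \<in> (\<Inter>i\<le>Suc n. P i (Suc n))"
  then show "a + b \<in> (\<Inter>i\<le>n. P i n)"
    using normal_seqD(4)[OF assms] by auto
qed

text \<open>Indexed by itself, \<open>D\<close> is uo-convergent to zero, hence convergent in
  \<open>\<tau>\<close>. The selection argument uses the convergence clause of the uo-Lebesgue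
  property of \<open>\<tau>\<close> in this form only.\<close>

lemma downward_null_meets_zero_nbhd:
  assumes D: "downward_null S D" and V: "zero_nbhd V"
  shows "\<exists>d\<in>D. d \<in> V"
proof -
  note net = downward_null_net[OF D]
  have pos: "0 \<le> d" if "d \<in> D" for d
    using D that by (auto simp: downward_null_def)
  have ev: "eventually (\<lambda>d. inf \<bar>d - 0\<bar> y \<le> c) (tails D (\<ge>))" if "c \<in> D" for c y
    unfolding eventually_tails[OF net(1)]
    by (intro bexI[of _ c] ballI impI) (use that pos in \<open>auto intro: le_infI1\<close>)
  have "uo_converges S D (\<ge>) (\<lambda>d. d) 0"
    unfolding uo_converges_iff[OF net(1)] using D ev by blast
  moreover have "(\<lambda>d. d) ` D \<subseteq> S" using D by (simp add: downward_null_def)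
  ultimately have "limitin \<tau> (\<lambda>d. d) 0 (tails D (\<ge>))"
    using uo_LebesgueD[OF uo_Lebesgue net(1)] mem(1) by blast
  moreover obtain W where "openin \<tau> W" "0 \<in> W" "W \<subseteq> V"
    using V by (auto simp: zero_nbhd_def)
  ultimately have "eventually (\<lambda>d. d \<in> V) (tails D (\<ge>))"
    unfolding limitin_def by (metis (mono_tags, lifting) eventually_mono subsetD)
  then show ?thesis
    unfolding eventually_tails[OF net(1)] by blast
qed

section \<open>Separating the points of an order interval by one normal sequence\<close>

lemma trivial_on_mono: "trivial_on Q f \<Longrightarrow> g \<le> f \<Longrightarrow> (\<And>n. P n \<subseteq> Q n) \<Longrightarrow> trivial_on P g"
  unfolding trivial_on_def by (meson order_trans subsetD)

text \<open>For \<open>w\<close> in both kernels, solidity puts \<open>inf w a\<close> and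
  \<open>inf w b\<close> into the respective kernels, so both vanish; \<open>inf_add_le\<close>
  bounds \<open>w\<close> by their sum.\<close>

lemma trivial_on_add:
  assumes P: "trivial_on P a" and Q: "trivial_on Q b" and "normal_seq P" "normal_seq Q"
    and ab: "a \<in> S" "b \<in> S" "0 \<le> a" "0 \<le> b"
  shows "trivial_on (\<lambda>n. P n \<inter> Q n) (a + b)"
  unfolding trivial_on_def
proof (intro ballI impI)
  fix w assume w: "w \<in> S" "0 \<le> w \<and> w \<le> a + b \<and> (\<forall>n. w \<in> P n \<inter> Q n)"
  have "inf w a \<in> P n" for n
    by (rule solid_mem[OF normal_seqD(1)[OF assms(3)], of w]) (use w ab mem in auto)
  then have "inf w a = 0"
    using P w ab mem unfolding trivial_on_def by (metis inf.bounded_iff inf_le2)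
  moreover have "inf w b \<in> Q n" for n
    by (rule solid_mem[OF normal_seqD(1)[OF assms(4)], of w]) (use w ab mem in auto)
  then have "inf w b = 0"
    using Q w ab mem unfolding trivial_on_def by (metis inf.bounded_iff inf_le2)
  moreover have "inf w (a + b) = w" using w by (simp add: inf_absorb1)
  ultimately show "w = 0"
    using inf_add_le[of w a b] w ab by simp
qed

text \<open>The Hausdorff property gives a normal sequence \<open>Q\<close> with \<open>c\<close>
  outside \<open>Q 0\<close>. If the claim failed, every \<open>z\<close> with
  \<open>0 < z \<le> c\<close> would dominate a nonzero kernel element of \<open>Q\<close>, and the
  kernel would exhaust \<open>c\<close>. Order continuity would then give a kernel element
  \<open>w\<close> with \<open>c - w\<close> in \<open>Q 1\<close>; as \<open>w\<close> is in
  \<open>Q 1\<close> too, \<open>c\<close> would lie in \<open>Q 0\<close>.\<close>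

lemma trivial_on_below:
  assumes c: "c \<in> S" "0 < c"
  shows "\<exists>d\<in>S. 0 < d \<and> d \<le> c \<and> (\<exists>Q. normal_seq Q \<and> trivial_on Q d)"
proof (rule ccontr)
  assume none: "\<not> ?thesis"
  obtain U V where "openin \<tau> U" "0 \<in> U" "c \<in> V" "disjnt U V"
    using hausdorff c mem(1) topspace unfolding Hausdorff_space_def by (metis less_irrefl)
  then have "zero_nbhd U" "c \<notin> U" by (auto simp: zero_nbhd_def disjnt_iff)
  then obtain Q where Q: "normal_seq Q" "c \<notin> Q 0"
    using normal_seq_exists by blast
  let ?N = "{w \<in> S. 0 \<le> w \<and> w \<le> c \<and> (\<forall>n. w \<in> Q n)}"
  have add: "p + q \<in> Q n" if "p \<in> ?N" "q \<in> ?N" for p q n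
    using that normal_seqD(4)[OF Q(1)] by blast
  have "downward_null S ((\<lambda>q. c - q) ` ?N)"
  proof (rule downward_null_exhaustion[OF S c(1)])
    show "0 \<in> ?N" using mem c normal_seqD(3)[OF Q(1)] by auto
    show "p + q \<in> ?N" if pq: "p \<in> ?N" "q \<in> ?N" "p + q \<le> c" for p q
      using add[OF pq(1,2)] pq mem by auto
    show "sup p q \<in> ?N" if pq: "p \<in> ?N" "q \<in> ?N" for p q
    proof -
      have "sup p q \<in> Q n" for n
        by (rule solid_mem[OF normal_seqD(1)[OF Q(1)] add[OF pq]])
          (use pq sup_le_add mem in \<open>auto intro: le_supI1\<close>)
      then show ?thesis using pq mem by (auto intro: le_supI1)
    qed
    show "\<exists>d\<in>?N. 0 < d \<and> d \<le> z" if z: "z \<in> S" "0 < z" "z \<le> c" for z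
    proof -
      have "\<not> trivial_on Q z" using none Q(1) z by blast
      then obtain w where "w \<in> S" "0 \<le> w" "w \<le> z" "\<forall>n. w \<in> Q n" "w \<noteq> 0"
        unfolding trivial_on_def by blast
      then show ?thesis using z by (intro bexI[of _ w]) auto
    qed
  qed auto
  from downward_null_meets_zero_nbhd[OF this normal_seqD(2)[OF Q(1), of 1]]
  obtain w where "w \<in> Q 1" "c - w \<in> Q 1" by blast
  then have "c - w + w \<in> Q 0" by (intro normal_seqD(4)[OF Q(1)]) simp_all
  with Q(2) show False by simp
qed

text \<open>The \<open>g\<close> below \<open>f\<close> that admit a trivial normal sequence exhaust
  \<open>f\<close>, by \<open>trivial_on_below\<close>. Countably many of them suffice, and the
  diagonal of their sequences works for \<open>f\<close>: an element of its kernel is disjoint from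
  each \<open>g i\<close>, hence below every \<open>f - g i\<close>.\<close>

lemma trivial_on_exists:
  assumes f: "f \<in> S" "0 \<le> f"
  obtains Q where "normal_seq Q" "trivial_on Q f"
proof -
  let ?H = "{g \<in> S. 0 \<le> g \<and> g \<le> f \<and> (\<exists>Q. normal_seq Q \<and> trivial_on Q g)}"
  have add: "\<exists>Q. normal_seq Q \<and> trivial_on Q (p + q)" if "p \<in> ?H" "q \<in> ?H" for p q
    using that normal_seq_Int trivial_on_add by blast
  obtain Q\<^sub>0 where Q\<^sub>0: "normal_seq Q\<^sub>0"
    using normal_seq_exists[OF zero_nbhd_space] by blast
  have "trivial_on Q\<^sub>0 0"
    unfolding trivial_on_def by (blast intro: order_antisym)
  with Q\<^sub>0 have zero: "0 \<in> ?H"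
    using f mem(1) by blast
  define D where "D = (\<lambda>q. f - q) ` ?H"
  have "downward_null S D"
    unfolding D_def
  proof (rule downward_null_exhaustion[OF S f(1)])
    show "p + q \<in> ?H" if pq: "p \<in> ?H" "q \<in> ?H" "p + q \<le> f" for p q
      using add[OF pq(1,2)] pq mem by auto
    show "sup p q \<in> ?H" if pq: "p \<in> ?H" "q \<in> ?H" for p q
    proof -
      obtain Q where "normal_seq Q" "trivial_on Q (p + q)" using add[OF pq] by blast
      moreover have "sup p q \<le> p + q" using pq sup_le_add by auto
      ultimately have "\<exists>Q. normal_seq Q \<and> trivial_on Q (sup p q)"
        using trivial_on_mono by blast
      then show ?thesis using pq mem by (auto intro: le_supI1)
    qed
    show "\<exists>d\<in>?H. 0 < d \<and> d \<le> z" if z: "z \<in> S" "0 < z" "z \<le> f" for z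
    proof -
      obtain d Q where "d \<in> S" "0 < d" "d \<le> z" "normal_seq Q" "trivial_on Q d"
        using trivial_on_below z by blast
      then show ?thesis using z by (intro bexI[of _ d]) auto
    qed
  qed (use zero in auto)
  from countable_glb[OF this]
  obtain C where C: "C \<subseteq> D" "countable C" "\<forall>z\<in>S. (\<forall>d\<in>C. z \<le> d) \<longrightarrow> z \<le> 0"
    by (elim exE conjE)
  \<comment> \<open>\<open>C\<close> may be empty, but an enumeration by
    \<open>from_nat_into\<close> needs an element; \<open>f = f - 0\<close> belongs to
    \<open>D\<close>.\<close>
  define C' where "C' = insert f C"
  have "f \<in> D" using imageI[OF zero, of "\<lambda>q. f - q"] by (simp add: D_def)
  then have C': "C' \<subseteq> D" "countable C'" "C' \<noteq> {}"
    using C by (auto simp: C'_def)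
  have "\<exists>g Q. from_nat_into C' i = f - g \<and> g \<in> S \<and> 0 \<le> g \<and> g \<le> f \<and> normal_seq Q \<and> trivial_on Q g"
    for i
  proof -
    have "from_nat_into C' i \<in> D" using from_nat_into[OF C'(3)] C'(1) by blast
    then show ?thesis unfolding D_def by blast
  qed
  then obtain g P where gP: "\<And>i. from_nat_into C' i = f - g i" "\<And>i. g i \<in> S" "\<And>i. 0 \<le> g i"
      "\<And>i. g i \<le> f" "\<And>i. normal_seq (P i)" "\<And>i. trivial_on (P i) (g i)"
    by metis
  let ?Q = "\<lambda>n. \<Inter>i\<le>n. P i n"
  have "trivial_on ?Q f"
    unfolding trivial_on_def
  proof (intro ballI impI)
    fix w assume w: "w \<in> S" "0 \<le> w \<and> w \<le> f \<and> (\<forall>n. w \<in> ?Q n)"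
    have "w \<le> f - g i" for i
    proof -
      have "w \<in> P i n" for n
      proof -
        \<comment> \<open>\<open>P i\<close> takes part in the diagonal only from index
          \<open>i\<close> on; smaller indices follow because \<open>P i\<close> is
          decreasing.\<close>
        have "w \<in> P i (max n i)" using w by (metis INT_iff atMost_iff max.cobounded2)
        then show ?thesis using normal_seq_antimono[OF gP(5), of n "max n i"] by auto
      qed
      then have "inf w (g i) \<in> P i n" for n
        by (rule solid_mem[OF normal_seqD(1)[OF gP(5)], of w])
          (use w gP(2,3) mem \<open>\<And>n. w \<in> P i n\<close> in auto)
      then have "inf w (g i) = 0"
        using gP(2,3,6) w mem unfolding trivial_on_def by (metis inf.bounded_iff inf_le2)
      moreover have "inf w (g i + (f - g i)) = w" using w by (simp add: inf_absorb1)
      ultimately have "w \<le> inf w (f - g i)"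
        using inf_add_le[of w "g i" "f - g i"] w gP(3,4) by simp
      then show ?thesis by simp
    qed
    then have "w \<le> d" if "d \<in> C" for d
      using that gP(1) from_nat_into_surj[OF C'(2), of d] by (auto simp: C'_def)
    with C(3) w show "w = 0" by (metis order_antisym)
  qed
  with normal_seq_diagonal[OF gP(5)] show thesis by (rule that)
qed

section \<open>The Borel-Cantelli argument\<close>

lemma normal_seq_sum:
  assumes W: "normal_seq W" and u: "\<And>n. u (Suc n) \<in> W n"
  shows "(\<Sum>j<m. u (Suc (Suc (n + j)))) \<in> W n"
proof (induction m arbitrary: n)
  case 0
  then show ?case using normal_seqD(3)[OF W] by simp
next
  case (Suc m)
  have "(\<Sum>j<m. u (Suc (Suc (Suc n + j)))) \<in> W (Suc n)" by (rule Suc)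
  \<comment> \<open>As in a geometric series, the first summand and the whole remaining sum both lie
    in \<open>W (n + 1)\<close>, and one halving puts their sum into \<open>W n\<close>.\<close>
  with u[of "Suc n"] have "u (Suc (Suc n)) + (\<Sum>j<m. u (Suc (Suc (Suc n + j)))) \<in> W n"
    by (intro normal_seqD(4)[OF W])
  then show ?case by (simp add: sum.lessThan_Suc_shift del: sum.lessThan_Suc)
qed

text \<open>
  A Borel-Cantelli argument: the partial sums \<open>T\<close> of a tail are small, and so are the upper
  bounds of \<open>T\<close> that lie close to \<open>T\<close>; a lower bound \<open>z\<close> of all eventual upper bounds is hence in every
  \<open>W n\<close>, which makes it disjoint from all \<open>u n\<close>.
\<close>

lemma summable_imp_eventual_bounds_null:
  assumes W: "normal_seq W" and u: "\<And>n. u n \<in> S" "\<And>n. 0 \<le> u n" "\<And>n. u (Suc n) \<in> W n"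
    and triv: "\<And>n. trivial_on W (u n)" and y: "y \<in> S" "0 \<le> y"
  shows "downward_null S {d \<in> S. eventually (\<lambda>n. inf (u n) y \<le> d) sequentially}"
    (is "downward_null S ?D")
proof (rule downward_nullI[OF S])
  have "y \<in> ?D" using y by simp
  then show "?D \<noteq> {}" by blast
  show "\<exists>c\<in>?D. c \<le> a \<and> c \<le> b" if "a \<in> ?D" "b \<in> ?D" for a b
    using that mem by (intro bexI[of _ "inf a b"]) (auto simp: eventually_conj_iff)
  show pos: "0 \<le> d" if d: "d \<in> ?D" for d
  proof -
    obtain n where "inf (u n) y \<le> d"
      using d eventually_happens'[OF sequentially_bot] by blast
    with u(2) y(2) show ?thesis by (meson le_infI order_trans)
  qed
  fix z assume z: "z \<in> S" "0 \<le> z" "\<And>d. d \<in> ?D \<Longrightarrow> z \<le> d"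
  have zW: "z \<in> W n" for n
  proof -
    \<comment> \<open>The sums start at \<open>u (n + 3)\<close> so that they land in
      \<open>W (n + 1)\<close>, leaving one halving for the step from \<open>t m\<close> to an upper
      bound. Truncation at \<open>y\<close> makes \<open>y\<close> itself an upper bound.\<close>
    define t where "t m = inf y (\<Sum>j<m. u (Suc (Suc (Suc n + j))))" for m
    have sum_S: "(\<Sum>j<m. u (Suc (Suc (Suc n + j)))) \<in> S" for m
      by (induction m) (auto intro: mem u)
    have t_pos: "0 \<le> t m" for m
      unfolding t_def using y u by (auto intro: sum_nonneg)
    have t_S: "t m \<in> S" for m
      unfolding t_def using y sum_S by (intro mem)
    have t_W: "t m \<in> W (Suc n)" for m
    proof (rule solid_mem[OF normal_seqD(1)[OF W] normal_seq_sum[OF W u(3)]])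
      show "t m \<le> (\<Sum>j<m. u (Suc (Suc (Suc n + j))))" by (simp add: t_def)
    qed (use t_S t_pos in auto)
    have t_mono: "t m \<le> t k" if "m \<le> k" for m k
      unfolding t_def using that u by (intro inf_mono order_refl sum_mono2) auto
    \<comment> \<open>\<open>u k\<close> is the summand with \<open>j = k - n - 3\<close>, the last
      of the first \<open>k - n - 2\<close> summands.\<close>
    have t_ge: "inf (u k) y \<le> t (k - n - 2)" if k: "k \<ge> n + 3" for k
    proof -
      have "u (Suc (Suc (Suc n + (k - n - 3)))) \<le> (\<Sum>j<k - n - 2. u (Suc (Suc (Suc n + j))))"
        using sum_mono2[of "{..<k - n - 2}" "{k - n - 3}" "\<lambda>j. u (Suc (Suc (Suc n + j)))"] k u(2)
        by simp
      moreover have "Suc (Suc (Suc n + (k - n - 3))) = k" using k by simp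
      ultimately show ?thesis unfolding t_def by (metis inf.commute inf_mono order_refl)
    qed
    \<comment> \<open>The upper bounds \<open>V\<close> stand in for the supremum of the
      \<open>t m\<close>, which need not exist. The differences \<open>v - t m\<close> have infimum
      zero, since a common lower bound can be subtracted from members of \<open>V\<close> for
      ever.\<close>
    define V where "V = {v \<in> S. \<forall>m. t m \<le> v}"
    have "downward_null S {v - t m |v m. v \<in> V}"
    proof (rule downward_nullI[OF S])
      have yV: "y \<in> V" using y by (simp add: V_def t_def)
      then show "{v - t m |v m. v \<in> V} \<noteq> {}" by blast
      show "{v - t m |v m. v \<in> V} \<subseteq> S" using mem t_S by (auto simp: V_def)
      show "0 \<le> d" if "d \<in> {v - t m |v m. v \<in> V}" for d
        using that by (auto simp: V_def)
      show "\<exists>c\<in>{v - t m |v m. v \<in> V}. c \<le> a \<and> c \<le> b"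
        if ab: "a \<in> {v - t m |v m. v \<in> V}" "b \<in> {v - t m |v m. v \<in> V}" for a b
      proof -
        obtain v m v' m' where *: "a = v - t m" "b = v' - t m'" "v \<in> V" "v' \<in> V"
          using ab by blast
        then have "inf v v' \<in> V" by (auto simp: V_def mem)
        then show ?thesis unfolding *
          by (intro bexI[of _ "inf v v' - t (max m m')"]) (auto intro!: diff_mono t_mono)
      qed
      fix w assume w: "w \<in> S" "0 \<le> w" "\<And>d. d \<in> {v - t m |v m. v \<in> V} \<Longrightarrow> w \<le> d"
      show "w = 0"
      proof (rule zero_if_translation_invariant_bounded_below[OF w(2) yV])
        show "q - w \<in> V" if q: "q \<in> V" for q
        proof -
          have "w \<le> q - t m" for m using q w(3) by blast
          then have "t m \<le> q - w" for m by (simp add: le_diff_eq add.commute)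
          then show ?thesis using q w mem by (auto simp: V_def)
        qed
        show "0 \<le> q" if "q \<in> V" for q
          using that t_pos[of 0] unfolding V_def by (auto intro: order_trans)
      qed
    qed
    from downward_null_meets_zero_nbhd[OF this normal_seqD(2)[OF W, of "Suc n"]]
    obtain v m where v: "v \<in> V" "v - t m \<in> W (Suc n)" by blast
    then have "v - t m + t m \<in> W n"
      using t_W by (intro normal_seqD(4)[OF W])
    then have vW: "v \<in> W n" by simp
    have "v \<in> ?D"
      using v(1) t_ge unfolding V_def eventually_sequentially by (blast intro: order_trans)
    then have "z \<le> v" by (rule z)
    with z(1,2) show ?thesis by (rule solid_mem[OF normal_seqD(1)[OF W] vW])
  qed
  have disj: "inf (u n) z = 0" for n
  proof -
    have "inf (u n) z \<in> W k" for k
      by (rule solid_mem[OF normal_seqD(1)[OF W] zW]) (use z(1,2) u mem in auto)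
    then show ?thesis
      using triv[of n] u z mem unfolding trivial_on_def by (metis inf.bounded_iff inf_le1)
  qed
  show "z = 0"
  \<comment> \<open>Disjointness of \<open>z\<close> from every \<open>u n\<close> keeps
    \<open>d - z\<close> an eventual upper bound, so \<open>z\<close> can be subtracted for ever
    although \<open>?D\<close> is bounded below by zero.\<close>
  proof (rule zero_if_translation_invariant_bounded_below[OF z(2) \<open>y \<in> ?D\<close>])
    fix d assume d: "d \<in> ?D"
    then have zd: "z \<le> d" by (rule z)
    have "inf (u n) y \<le> d - z" if "inf (u n) y \<le> d" for n
    proof -
      have "inf (u n) y \<le> inf (u n) ((d - z) + z)" using that by simp
      also have "\<dots> \<le> inf (u n) (d - z) + inf (u n) z"
        using u z zd by (intro inf_add_le) auto
      also have "\<dots> \<le> d - z" by (simp add: disj)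
      finally show ?thesis .
    qed
    then show "d - z \<in> ?D"
      using d z mem by (auto elim: eventually_mono)
  qed (rule pos)
qed auto

section \<open>Selecting the sequence\<close>

lemma limitin_imp_eventually_abs_diff:
  assumes lim: "limitin \<tau> x l L" and V: "zero_nbhd V" "solid_in S V"
    and x: "eventually (\<lambda>a. x a \<in> S) L"
  shows "eventually (\<lambda>a. \<bar>x a - l\<bar> \<in> V) L"
proof -
  obtain W where W: "openin \<tau> W" "0 \<in> W" "W \<subseteq> V"
    using V by (auto simp: zero_nbhd_def)
  have l: "l \<in> S" using lim topspace by (simp add: limitin_def)
  have "continuous_map \<tau> (prod_topology \<tau> \<tau>) (\<lambda>v. (v, - l))"
    using l mem topspace by (simp add: continuous_map_pairedI)
  from continuous_map_compose[OF this continuous_add]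
  have "continuous_map \<tau> \<tau> (\<lambda>v. v - l)" by (simp add: o_def)
  then have "openin \<tau> {v \<in> topspace \<tau>. v - l \<in> W}"
    using W(1) by (rule openin_continuous_map_preimage)
  moreover have "l \<in> {v \<in> topspace \<tau>. v - l \<in> W}" using W l topspace by simp
  ultimately have "eventually (\<lambda>a. x a \<in> {v \<in> topspace \<tau>. v - l \<in> W}) L"
    using lim unfolding limitin_def by blast
  then show ?thesis
  proof (rule eventually_mono)
    fix a assume "x a \<in> {v \<in> topspace \<tau>. v - l \<in> W}"
    then have "x a - l \<in> V" "x a - l \<in> S" using W l mem topspace by auto
    then show "\<bar>x a - l\<bar> \<in> V"
      using V(2) mem(8) unfolding solid_in_def by (metis abs_idempotent order_refl)
  qed
qed

text \<open>Each demand on the next index holds eventually along the proper filter \<open>L\<close>,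
  so all can be met at once. The parameters \<open>A\<close>, \<open>R\<close> and \<open>L\<close>
  are left free for three uses: prescribed indices in a net, strictly increasing indices of a
  subsequence, and points outside a given set in the uniqueness proof.\<close>

lemma uo_convergent_selection:
  fixes x :: "'i \<Rightarrow> 'a"
  assumes lim: "limitin \<tau> x l L" and L: "L \<noteq> bot" and A: "x ` A \<subseteq> S" "a\<^sub>0 \<in> A"
    and next_ev: "\<And>n a. a \<in> A \<Longrightarrow> eventually (\<lambda>b. b \<in> A \<and> R n a b) L"
  obtains \<alpha> where "\<alpha> 0 = a\<^sub>0" "\<And>n. \<alpha> n \<in> A" "\<And>n. R n (\<alpha> n) (\<alpha> (Suc n))"
    "uo_converges S (UNIV :: nat set) (\<le>) (\<lambda>n. x (\<alpha> n)) l"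
proof -
  define u where "u a = \<bar>x a - l\<bar>" for a
  have l: "l \<in> S" using lim topspace by (simp add: limitin_def)
  have u: "u a \<in> S" "0 \<le> u a" if "a \<in> A" for a
  proof -
    have "x a \<in> S" using A(1) that by blast
    then show "u a \<in> S" "0 \<le> u a" using l mem(3,8) by (simp_all add: u_def)
  qed
  \<comment> \<open>The state pairs an index with a normal sequence that is trivial below its
    distance to \<open>l\<close>. A new index is chosen by \<open>Q 1\<close> of its predecessor,
    before its own sequence is known; the shift from \<open>k\<close> to \<open>k + 1\<close> in
    \<open>?R\<close> makes the sets \<open>Q n 0\<close> a normal sequence.\<close>
  let ?P = "\<lambda>n (a, Q). (n = 0 \<longrightarrow> a = a\<^sub>0) \<and> a \<in> A \<and> normal_seq Q \<and> trivial_on Q (u a)"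
  let ?R = "\<lambda>n (a, Q) (b, Q'). R n a b \<and> u b \<in> Q 1 \<and> (\<forall>k. Q' k \<subseteq> Q (Suc k))"
  have "\<exists>s. \<forall>n::nat. ?P n (s n) \<and> ?R n (s n) (s (Suc n))"
  proof (rule dependent_nat_choice)
    show "\<exists>p. ?P 0 p"
    proof -
      obtain Q where "normal_seq Q" "trivial_on Q (u a\<^sub>0)"
        using trivial_on_exists[OF u] A(2) by blast
      then show ?thesis using A(2) by (intro exI[of _ "(a\<^sub>0, Q)"]) simp
    qed
    fix p :: "'i \<times> (nat \<Rightarrow> 'a set)" and n :: nat
    obtain a Q where p: "p = (a, Q)" by fastforce
    assume "?P n p"
    then have aQ: "a \<in> A" "normal_seq Q" "trivial_on Q (u a)" by (auto simp: p)
    have "eventually (\<lambda>b. x b \<in> S) L"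
      by (rule eventually_mono[OF next_ev[OF aQ(1), of n]]) (use A(1) in blast)
    then have "eventually (\<lambda>b. u b \<in> Q 1) L"
      unfolding u_def using normal_seqD(1,2)[OF aQ(2)]
      by (intro limitin_imp_eventually_abs_diff[OF lim])
    with next_ev[OF aQ(1)] have "eventually (\<lambda>b. (b \<in> A \<and> R n a b) \<and> u b \<in> Q 1) L"
      by (rule eventually_conj)
    with L obtain b where b: "b \<in> A" "R n a b" "u b \<in> Q 1"
      using eventually_happens' by blast
    obtain T where T: "normal_seq T" "trivial_on T (u b)"
      using trivial_on_exists[OF u] b(1) by blast
    have "normal_seq (\<lambda>n. Q (Suc n) \<inter> T n)"
      using aQ T by (intro normal_seq_Int normal_seq_shift)
    moreover have "trivial_on (\<lambda>n. Q (Suc n) \<inter> T n) (u b)"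
      using T(2) by (rule trivial_on_mono) auto
    ultimately have "?P (Suc n) (b, \<lambda>n. Q (Suc n) \<inter> T n) \<and> ?R n p (b, \<lambda>n. Q (Suc n) \<inter> T n)"
      using b by (simp add: p)
    then show "\<exists>q. ?P (Suc n) q \<and> ?R n p q" by blast
  qed
  then obtain s where s: "\<And>n::nat. ?P n (s n) \<and> ?R n (s n) (s (Suc n))" by blast
  define \<alpha> Q W where "\<alpha> n = fst (s n)" and "Q n = snd (s n)" and "W n = Q n 0" for n
  have s_eq: "s n = (\<alpha> n, Q n)" for n by (simp add: \<alpha>_def Q_def)
  have \<alpha>: "\<alpha> 0 = a\<^sub>0" "\<alpha> n \<in> A" "R n (\<alpha> n) (\<alpha> (Suc n))"
    and Q: "normal_seq (Q n)" "trivial_on (Q n) (u (\<alpha> n))" "Q (Suc n) k \<subseteq> Q n (Suc k)"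
    and uQ: "u (\<alpha> (Suc n)) \<in> Q n 1" for n k
    using s[of n] s[of 0] by (simp_all add: s_eq)
  have W: "normal_seq W"
    unfolding normal_seq_def W_def
  proof (intro allI conjI ballI)
    fix n a b assume "a \<in> Q (Suc n) 0" "b \<in> Q (Suc n) 0"
    then show "a + b \<in> Q n 0"
      using Q(3)[of n 0] by (intro normal_seqD(4)[OF Q(1)]) auto
  qed (rule normal_seqD(1,2)[OF Q(1)])+
  have uW: "u (\<alpha> (Suc n)) \<in> W n" for n
    using uQ normal_seq_antimono[OF Q(1), of 0 1 n] by (auto simp: W_def)
  \<comment> \<open>For \<open>k = 0\<close>, an element of all \<open>W m\<close> lies in every
    \<open>Q n i\<close>; so \<open>W\<close> inherits triviality below each
    \<open>u (\<alpha> n)\<close>, for old terms as well as new ones.\<close>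
  have QQ: "Q (n + i) k \<subseteq> Q n (i + k)" for n i k
  proof (induction i arbitrary: k)
    case (Suc i)
    then show ?case using Q(3)[of "n + i" k] by fastforce
  qed simp
  have triv: "trivial_on W (u (\<alpha> n))" for n
    unfolding trivial_on_def
  proof (intro ballI impI)
    fix w assume w: "w \<in> S" "0 \<le> w \<and> w \<le> u (\<alpha> n) \<and> (\<forall>k. w \<in> W k)"
    then have "w \<in> Q n i" for i using QQ[of n i 0] by (auto simp: W_def)
    with w Q(2)[of n] show "w = 0" by (auto simp: trivial_on_def)
  qed
  have "uo_converges S UNIV (\<le>) (\<lambda>n. x (\<alpha> n)) l"
    unfolding uo_converges_iff[OF directed_set_nat] tails_nat u_def[symmetric]
  proof (intro ballI impI)
    fix y assume "y \<in> S" "0 \<le> y"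
    with W uW triv u \<alpha> show "\<exists>D. downward_null S D \<and>
        (\<forall>d\<in>D. eventually (\<lambda>n. inf (u (\<alpha> n)) y \<le> d) sequentially)"
      by (intro exI[of _ "{d \<in> S. eventually (\<lambda>n. inf (u (\<alpha> n)) y \<le> d) sequentially}"] conjI
          summable_imp_eventual_bounds_null[of W]) auto
  qed
  with that \<alpha> show thesis by blast
qed

end

section \<open>Topologies given by solid pseudonorms\<close>

text \<open>Truncation at \<open>f\<close> destroys homogeneity; the last clause supplies the
  continuity of scalar multiplication at zero that homogeneity would have given.\<close>

definition solid_pseudonorm :: "('a::archimedean_vector_lattice \<Rightarrow> real) \<Rightarrow> bool" where
  "solid_pseudonorm \<rho> \<longleftrightarrow> \<rho> 0 = 0 \<and> (\<forall>x y. \<bar>x\<bar> \<le> \<bar>y\<bar> \<longrightarrow> \<rho> x \<le> \<rho> y) \<and>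
     (\<forall>x y. \<rho> (x + y) \<le> \<rho> x + \<rho> y) \<and>
     (\<forall>x e. 0 < e \<longrightarrow> (\<exists>n. \<rho> ((1 / real (Suc n)) *\<^sub>R x) < e))"

lemma solid_pseudonormD:
  assumes "solid_pseudonorm \<rho>"
  shows "\<rho> 0 = 0" "\<bar>x\<bar> \<le> \<bar>y\<bar> \<Longrightarrow> \<rho> x \<le> \<rho> y" "\<rho> (x + y) \<le> \<rho> x + \<rho> y"
    "0 < e \<Longrightarrow> \<exists>n. \<rho> ((1 / real (Suc n)) *\<^sub>R x) < e"
    "\<rho> (x - z) \<le> \<rho> (x - y) + \<rho> (y - z)" "\<rho> (x - y) = \<rho> (y - x)" "0 \<le> \<rho> x"
proof -
  show "\<rho> 0 = 0" "\<bar>x\<bar> \<le> \<bar>y\<bar> \<Longrightarrow> \<rho> x \<le> \<rho> y" "\<rho> (x + y) \<le> \<rho> x + \<rho> y"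
    "0 < e \<Longrightarrow> \<exists>n. \<rho> ((1 / real (Suc n)) *\<^sub>R x) < e" for x y e
    using assms unfolding solid_pseudonorm_def by blast+
  note * = this
  show "\<rho> (x - z) \<le> \<rho> (x - y) + \<rho> (y - z)" using *(3)[of "x - y" "y - z"] by simp
  show "\<rho> (x - y) = \<rho> (y - x)"
    by (rule order_antisym; rule *(2); simp add: abs_minus_commute)
  show "0 \<le> \<rho> x" using *(2)[of 0 x] *(1) by simp
qed

text \<open>Solidity replaces \<open>c\<close> by the integer \<open>n\<close>, and the triangle
  inequality is applied \<open>n\<close> times.\<close>

lemma solid_pseudonorm_scale_le:
  assumes "solid_pseudonorm \<rho>" "\<bar>c\<bar> \<le> real n"
  shows "\<rho> (c *\<^sub>R x) \<le> real n * \<rho> x"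
proof -
  note \<rho> = solid_pseudonormD[OF assms(1)]
  have "\<bar>c *\<^sub>R x\<bar> \<le> \<bar>real n *\<^sub>R x\<bar>"
    using assms(2) by (simp add: abs_scaleR_eq scaleR_right_mono)
  then have "\<rho> (c *\<^sub>R x) \<le> \<rho> (real n *\<^sub>R x)" by (rule \<rho>)
  also have "\<rho> (real n *\<^sub>R x) \<le> real n * \<rho> x"
  proof (induction n)
    case (Suc n)
    have "\<rho> (x + real n *\<^sub>R x) \<le> \<rho> x + real n * \<rho> x"
      using \<rho>(3)[of x "real n *\<^sub>R x"] Suc by linarith
    then show ?case by (simp add: scaleR_add_left distrib_right)
  qed (simp add: \<rho>)
  finally show ?thesis .
qed

definition pseudonorm_topology ::
    "'a::archimedean_vector_lattice set \<Rightarrow> ('a \<Rightarrow> real) set \<Rightarrow> 'a topology" where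
  "pseudonorm_topology S R = topology (\<lambda>U. U \<subseteq> S \<and> (\<forall>x\<in>U. \<exists>K e. finite K \<and> K \<subseteq> R \<and> 0 < e \<and>
     (\<forall>y\<in>S. (\<forall>\<rho>\<in>K. \<rho> (y - x) < e) \<longrightarrow> y \<in> U)))"

lemma openin_pseudonorm_topology:
  "openin (pseudonorm_topology S R) U \<longleftrightarrow> U \<subseteq> S \<and> (\<forall>x\<in>U. \<exists>K e. finite K \<and> K \<subseteq> R \<and> 0 < e \<and>
     (\<forall>y\<in>S. (\<forall>\<rho>\<in>K. \<rho> (y - x) < e) \<longrightarrow> y \<in> U))"
proof -
  let ?ok = "\<lambda>U. U \<subseteq> S \<and> (\<forall>x\<in>U. \<exists>K e. finite K \<and> K \<subseteq> R \<and> 0 < e \<and>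
     (\<forall>y\<in>S. (\<forall>\<rho>\<in>K. \<rho> (y - x) < e) \<longrightarrow> y \<in> U))"
  have "istopology ?ok"
    unfolding istopology_def
  proof (intro conjI allI impI)
    fix U V assume U: "?ok U" and V: "?ok V"
    show "U \<inter> V \<subseteq> S" using U by blast
    show "\<forall>x\<in>U \<inter> V. \<exists>K e. finite K \<and> K \<subseteq> R \<and> 0 < e \<and>
        (\<forall>y\<in>S. (\<forall>\<rho>\<in>K. \<rho> (y - x) < e) \<longrightarrow> y \<in> U \<inter> V)"
    proof
      fix x assume "x \<in> U \<inter> V"
      then obtain K e K' e' where
        "finite K" "K \<subseteq> R" "0 < e" "\<forall>y\<in>S. (\<forall>\<rho>\<in>K. \<rho> (y - x) < e) \<longrightarrow> y \<in> U"
        "finite K'" "K' \<subseteq> R" "0 < e'" "\<forall>y\<in>S. (\<forall>\<rho>\<in>K'. \<rho> (y - x) < e') \<longrightarrow> y \<in> V"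
        using U V by (metis IntD1 IntD2)
      then show "\<exists>K e. finite K \<and> K \<subseteq> R \<and> 0 < e \<and>
          (\<forall>y\<in>S. (\<forall>\<rho>\<in>K. \<rho> (y - x) < e) \<longrightarrow> y \<in> U \<inter> V)"
        by (intro exI[of _ "K \<union> K'"] exI[of _ "min e e'"]) auto
    qed
  next
    fix \<U> assume \<U>: "\<forall>U\<in>\<U>. ?ok U"
    then show "\<Union>\<U> \<subseteq> S" by blast
    show "\<forall>x\<in>\<Union>\<U>. \<exists>K e. finite K \<and> K \<subseteq> R \<and> 0 < e \<and>
        (\<forall>y\<in>S. (\<forall>\<rho>\<in>K. \<rho> (y - x) < e) \<longrightarrow> y \<in> \<Union>\<U>)"
    proof
      fix x assume "x \<in> \<Union>\<U>"
      then obtain U where U: "U \<in> \<U>" "x \<in> U" by blast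
      with \<U> obtain K e where
        "finite K" "K \<subseteq> R" "0 < e" "\<forall>y\<in>S. (\<forall>\<rho>\<in>K. \<rho> (y - x) < e) \<longrightarrow> y \<in> U"
        by metis
      with U show "\<exists>K e. finite K \<and> K \<subseteq> R \<and> 0 < e \<and>
          (\<forall>y\<in>S. (\<forall>\<rho>\<in>K. \<rho> (y - x) < e) \<longrightarrow> y \<in> \<Union>\<U>)"
        by (intro exI[of _ K] exI[of _ e]) blast
    qed
  qed
  then show ?thesis
    unfolding pseudonorm_topology_def by (simp add: topology_inverse')
qed

context
  fixes S :: "'a::archimedean_vector_lattice set" and R :: "('a \<Rightarrow> real) set"
  assumes S: "vector_sublattice S" and R: "\<And>\<rho>. \<rho> \<in> R \<Longrightarrow> solid_pseudonorm \<rho>"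
begin

lemma topspace_pseudonorm_topology: "topspace (pseudonorm_topology S R) = S"
proof
  show "topspace (pseudonorm_topology S R) \<subseteq> S"
    using openin_topspace openin_pseudonorm_topology by metis
  have "openin (pseudonorm_topology S R) S"
    unfolding openin_pseudonorm_topology
    by (intro conjI ballI exI[of _ "{}"] exI[of _ "1::real"]) auto
  then show "S \<subseteq> topspace (pseudonorm_topology S R)" by (rule openin_subset)
qed

lemma openin_pseudonorm_ball:
  assumes "\<rho> \<in> R"
  shows "openin (pseudonorm_topology S R) {y \<in> S. \<rho> (y - x) < e}"
  unfolding openin_pseudonorm_topology
proof (intro conjI ballI)
  fix y assume y: "y \<in> {y \<in> S. \<rho> (y - x) < e}"
  have "\<rho> (z - x) < e" if "\<rho> (z - y) < e - \<rho> (y - x)" for z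
    using that solid_pseudonormD(5)[OF R[OF assms], of z x y] by linarith
  then show "\<exists>K e'. finite K \<and> K \<subseteq> R \<and> 0 < e' \<and>
      (\<forall>z\<in>S. (\<forall>\<rho>\<in>K. \<rho> (z - y) < e') \<longrightarrow> z \<in> {y \<in> S. \<rho> (y - x) < e})"
    using y assms by (intro exI[of _ "{\<rho>}"] exI[of _ "e - \<rho> (y - x)"]) auto
qed auto

lemma limitin_pseudonorm_topology:
  "limitin (pseudonorm_topology S R) x l L \<longleftrightarrow>
     l \<in> S \<and> eventually (\<lambda>a. x a \<in> S) L \<and> (\<forall>\<rho>\<in>R. \<forall>e>0. eventually (\<lambda>a. \<rho> (x a - l) < e) L)"
proof (intro iffI conjI ballI allI impI)
  assume lim: "limitin (pseudonorm_topology S R) x l L"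
  then show l: "l \<in> S" by (simp add: limitin_def topspace_pseudonorm_topology)
  show "eventually (\<lambda>a. x a \<in> S) L"
    using lim l topspace_pseudonorm_topology openin_topspace unfolding limitin_def by metis
  fix \<rho> e assume \<rho>: "\<rho> \<in> R" and e: "0 < (e::real)"
  then have "l \<in> {y \<in> S. \<rho> (y - l) < e}"
    using l solid_pseudonormD(1)[OF R[OF \<rho>]] by simp
  then have "eventually (\<lambda>a. x a \<in> {y \<in> S. \<rho> (y - l) < e}) L"
    using lim openin_pseudonorm_ball[OF \<rho>] unfolding limitin_def by blast
  then show "eventually (\<lambda>a. \<rho> (x a - l) < e) L" by (rule eventually_mono) simp
next
  assume *: "l \<in> S \<and> eventually (\<lambda>a. x a \<in> S) L \<and>
    (\<forall>\<rho>\<in>R. \<forall>e>0. eventually (\<lambda>a. \<rho> (x a - l) < e) L)"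
  show "limitin (pseudonorm_topology S R) x l L"
    unfolding limitin_def topspace_pseudonorm_topology
  proof (intro conjI allI impI)
    show "l \<in> S" using * by blast
    fix U assume "openin (pseudonorm_topology S R) U \<and> l \<in> U"
    then obtain K e where K: "finite K" "K \<subseteq> R" "0 < e"
        "\<forall>y\<in>S. (\<forall>\<rho>\<in>K. \<rho> (y - l) < e) \<longrightarrow> y \<in> U"
      unfolding openin_pseudonorm_topology by metis
    then have "eventually (\<lambda>a. \<forall>\<rho>\<in>K. \<rho> (x a - l) < e) L"
      using * by (intro eventually_ball_finite) auto
    with * have "eventually (\<lambda>a. x a \<in> S \<and> (\<forall>\<rho>\<in>K. \<rho> (x a - l) < e)) L"
      by (simp add: eventually_conj_iff)
    then show "eventually (\<lambda>a. x a \<in> U) L"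
      by (rule eventually_mono) (use K in blast)
  qed
qed

lemma limitin_pseudonorm_add:
  assumes "limitin (pseudonorm_topology S R) x l L" "limitin (pseudonorm_topology S R) y m L"
  shows "limitin (pseudonorm_topology S R) (\<lambda>a. x a + y a) (l + m) L"
  unfolding limitin_pseudonorm_topology
proof (intro conjI ballI allI impI)
  note xy = assms[unfolded limitin_pseudonorm_topology]
  show "l + m \<in> S" using xy vector_sublattice_mem[OF S] by blast
  have "eventually (\<lambda>a. x a \<in> S \<and> y a \<in> S) L" using xy by (simp add: eventually_conj_iff)
  then show "eventually (\<lambda>a. x a + y a \<in> S) L"
    by (rule eventually_mono) (use vector_sublattice_mem[OF S] in blast)
  fix \<rho> e assume \<rho>: "\<rho> \<in> R" and e: "0 < (e::real)"
  then have "eventually (\<lambda>a. \<rho> (x a - l) < e / 2) L" "eventually (\<lambda>a. \<rho> (y a - m) < e / 2) L"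
    using xy half_gt_zero by blast+
  then have "eventually (\<lambda>a. \<rho> (x a - l) < e / 2 \<and> \<rho> (y a - m) < e / 2) L"
    by (rule eventually_conj)
  then show "eventually (\<lambda>a. \<rho> (x a + y a - (l + m)) < e) L"
  proof (rule eventually_mono)
    fix a assume "\<rho> (x a - l) < e / 2 \<and> \<rho> (y a - m) < e / 2"
    moreover have "\<rho> (x a + y a - (l + m)) \<le> \<rho> (x a - l) + \<rho> (y a - m)"
      using solid_pseudonormD(3)[OF R[OF \<rho>], of "x a - l" "y a - m"] by (simp add: algebra_simps)
    ultimately show "\<rho> (x a + y a - (l + m)) < e" by linarith
  qed
qed

text \<open>The difference is split as
  \<open>c a *\<^sub>R (x a - l) + (c a - r) *\<^sub>R l\<close>. The first part is controlled by an
  integer bound for the coefficients, the second by the last clause of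
  \<open>solid_pseudonorm\<close>.\<close>

lemma limitin_pseudonorm_scaleR:
  assumes c: "(c \<longlongrightarrow> r) L" and x: "limitin (pseudonorm_topology S R) x l L"
  shows "limitin (pseudonorm_topology S R) (\<lambda>a. c a *\<^sub>R x a) (r *\<^sub>R l) L"
  unfolding limitin_pseudonorm_topology
proof (intro conjI ballI allI impI)
  note x' = x[unfolded limitin_pseudonorm_topology]
  show "r *\<^sub>R l \<in> S" using x' vector_sublattice_mem(5)[OF S] by blast
  have "eventually (\<lambda>a. x a \<in> S) L" using x' by blast
  then show "eventually (\<lambda>a. c a *\<^sub>R x a \<in> S) L"
    by (rule eventually_mono) (rule vector_sublattice_mem(5)[OF S])
  fix \<rho> e assume \<rho>: "\<rho> \<in> R" and e: "0 < (e::real)"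
  note \<rho>' = solid_pseudonormD[OF R[OF \<rho>]]
  obtain m where m: "\<rho> ((1 / real (Suc m)) *\<^sub>R l) < e / 2"
    using \<rho>'(4)[of "e / 2"] e by auto
  \<comment> \<open>This \<open>n\<close> bounds \<open>\<bar>c a\<bar>\<close> as soon as
    \<open>c a\<close> is within 1 of \<open>r\<close>.\<close>
  obtain n where n: "\<bar>r\<bar> + 1 \<le> real n" using real_arch_simple by blast
  then have n0: "0 < real n" by linarith
  have "eventually (\<lambda>a. \<bar>c a - r\<bar> < min 1 (1 / real (Suc m))) L"
    using c tendstoD[OF c, of "min 1 (1 / real (Suc m))"] by (simp add: dist_real_def)
  moreover have "eventually (\<lambda>a. \<rho> (x a - l) < e / 2 / real n) L"
    using x' \<rho> e n0 half_gt_zero divide_pos_pos by blast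
  ultimately show "eventually (\<lambda>a. \<rho> (c a *\<^sub>R x a - r *\<^sub>R l) < e) L"
  proof (eventually_elim)
    case (elim a)
    have "\<rho> (c a *\<^sub>R (x a - l)) \<le> real n * \<rho> (x a - l)"
      using elim n by (intro solid_pseudonorm_scale_le[OF R[OF \<rho>]]) linarith
    also have "\<dots> < e / 2" using elim n0 by (simp add: field_simps)
    finally have 1: "\<rho> (c a *\<^sub>R (x a - l)) < e / 2" .
    have "\<bar>c a - r\<bar> *\<^sub>R \<bar>l\<bar> \<le> \<bar>1 / real (Suc m)\<bar> *\<^sub>R \<bar>l\<bar>"
      using elim by (intro scaleR_right_mono) auto
    then have "\<rho> ((c a - r) *\<^sub>R l) \<le> \<rho> ((1 / real (Suc m)) *\<^sub>R l)"
      by (intro \<rho>'(2)) (simp only: abs_scaleR_eq)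
    with m 1 \<rho>'(3)[of "c a *\<^sub>R (x a - l)" "(c a - r) *\<^sub>R l"] show ?case
      by (simp add: algebra_simps)
  qed
qed

lemma linear_topology_pseudonorm: "linear_topology S (pseudonorm_topology S R)"
  unfolding linear_topology_def
proof (intro conjI topspace_pseudonorm_topology)
  let ?\<tau> = "pseudonorm_topology S R"
  show "continuous_map (prod_topology ?\<tau> ?\<tau>) ?\<tau> (\<lambda>(x, y). x + y)"
    unfolding continuous_map_atin case_prod_unfold
  proof
    fix p assume "p \<in> topspace (prod_topology ?\<tau> ?\<tau>)"
    then show "limitin ?\<tau> (\<lambda>p. fst p + snd p) (fst p + snd p) (atin (prod_topology ?\<tau> ?\<tau>) p)"
      using continuous_map_fst[of ?\<tau> ?\<tau>] continuous_map_snd[of ?\<tau> ?\<tau>]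
      unfolding continuous_map_atin by (intro limitin_pseudonorm_add) blast+
  qed
  show "continuous_map (prod_topology euclideanreal ?\<tau>) ?\<tau> (\<lambda>(c, x). c *\<^sub>R x)"
    unfolding continuous_map_atin case_prod_unfold
  proof
    fix p assume p: "p \<in> topspace (prod_topology euclideanreal ?\<tau>)"
    have "limitin euclideanreal fst (fst p) (atin (prod_topology euclideanreal ?\<tau>) p)"
      using p continuous_map_fst[of euclideanreal ?\<tau>] unfolding continuous_map_atin by blast
    then show "limitin ?\<tau> (\<lambda>p. fst p *\<^sub>R snd p) (fst p *\<^sub>R snd p)
        (atin (prod_topology euclideanreal ?\<tau>) p)"
      using p continuous_map_snd[of euclideanreal ?\<tau>] unfolding continuous_map_atin
      by (intro limitin_pseudonorm_scaleR) (simp, blast)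
  qed
qed

lemma locally_solid_pseudonorm: "locally_solid S (pseudonorm_topology S R)"
  unfolding locally_solid_def
proof (intro allI impI)
  fix U assume "openin (pseudonorm_topology S R) U \<and> 0 \<in> U"
  then obtain K e where K: "finite K" "K \<subseteq> R" "0 < e"
      "\<forall>y\<in>S. (\<forall>\<rho>\<in>K. \<rho> (y - 0) < e) \<longrightarrow> y \<in> U"
    unfolding openin_pseudonorm_topology by metis
  \<comment> \<open>The factor \<open>S\<close> is there for empty \<open>K\<close>, where the
    indexed intersection is the whole type.\<close>
  define V where "V = S \<inter> (\<Inter>\<rho>\<in>K. {y \<in> S. \<rho> (y - 0) < e})"
  have "openin (pseudonorm_topology S R) V"
    unfolding V_def
  proof (cases "K = {}")
    case True
    then show "openin (pseudonorm_topology S R) (S \<inter> (\<Inter>\<rho>\<in>K. {y \<in> S. \<rho> (y - 0) < e}))"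
      using openin_topspace[of "pseudonorm_topology S R"] topspace_pseudonorm_topology by simp
  next
    case False
    then have "S \<inter> (\<Inter>\<rho>\<in>K. {y \<in> S. \<rho> (y - 0) < e}) = (\<Inter>\<rho>\<in>K. {y \<in> S. \<rho> (y - 0) < e})"
      by blast
    with K False show "openin (pseudonorm_topology S R) (S \<inter> (\<Inter>\<rho>\<in>K. {y \<in> S. \<rho> (y - 0) < e}))"
      using openin_pseudonorm_ball[of _ 0 e] by (auto intro!: openin_Inter)
  qed
  moreover have "0 \<in> V"
  proof -
    have "\<rho> 0 < e" if "\<rho> \<in> K" for \<rho>
      using solid_pseudonormD(1)[OF R, of \<rho>] that K(2,3) by auto
    then show ?thesis using vector_sublattice_mem(1)[OF S] by (simp add: V_def)
  qed
  moreover have "V \<subseteq> U" using K by (auto simp: V_def)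
  moreover have "solid_in S V"
    unfolding solid_in_def
  proof (intro conjI ballI impI)
    fix v x assume v: "v \<in> V" "x \<in> S" "\<bar>x\<bar> \<le> \<bar>v\<bar>"
    have "\<rho> x < e" if "\<rho> \<in> K" for \<rho>
    proof -
      have "\<rho> \<in> R" "\<rho> v < e" using v(1) that K(2) by (auto simp: V_def)
      with solid_pseudonormD(2)[OF R v(3)] show ?thesis by (blast intro: le_less_trans)
    qed
    with v show "x \<in> V" by (simp add: V_def)
  qed (simp add: V_def)
  ultimately show "\<exists>V W. solid_in S V \<and> V \<subseteq> U \<and> openin (pseudonorm_topology S R) W \<and> 0 \<in> W \<and> W \<subseteq> V"
    by blast
qed

lemma Hausdorff_pseudonorm:
  assumes "\<And>x. x \<in> S \<Longrightarrow> x \<noteq> 0 \<Longrightarrow> \<exists>\<rho>\<in>R. 0 < \<rho> x"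
  shows "Hausdorff_space (pseudonorm_topology S R)"
  unfolding Hausdorff_space_def topspace_pseudonorm_topology
proof (intro allI impI)
  fix x y assume xy: "x \<in> S \<and> y \<in> S \<and> x \<noteq> y"
  then obtain \<rho> where \<rho>: "\<rho> \<in> R" "0 < \<rho> (x - y)"
    using assms[of "x - y"] vector_sublattice_mem(3)[OF S] by auto
  note \<rho>' = solid_pseudonormD[OF R[OF \<rho>(1)]]
  let ?B = "\<lambda>x. {z \<in> S. \<rho> (z - x) < \<rho> (x - y) / 2}"
  let ?C = "{z \<in> S. \<rho> (z - y) < \<rho> (x - y) / 2}"
  have "z \<notin> ?C" if "z \<in> ?B x" for z
    using that \<rho>'(5)[of x y z] \<rho>'(6)[of x z] by auto
  then have "disjnt (?B x) ?C" by (auto simp: disjnt_iff)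
  moreover have "x \<in> ?B x" "y \<in> ?C" using xy \<rho> \<rho>'(1) by auto
  ultimately show "\<exists>U V. openin (pseudonorm_topology S R) U \<and> openin (pseudonorm_topology S R) V \<and>
      x \<in> U \<and> y \<in> V \<and> disjnt U V"
    using openin_pseudonorm_ball[OF \<rho>(1)] by blast
qed

end

section \<open>The modulus of an order continuous functional\<close>

text \<open>The first summand is explicit, the truncation of \<open>z\<close> to the interval from
  \<open>- a\<close> to \<open>a\<close>. It therefore stays in every sublattice containing
  \<open>z\<close> and \<open>a\<close>, and it depends on \<open>a\<close> in a way that can be
  followed along a net.\<close>

lemma Riesz_decomposition:
  fixes z a b :: "'a::archimedean_vector_lattice"
  assumes "\<bar>z\<bar> \<le> a + b" "0 \<le> a" "0 \<le> b"
  shows "\<bar>sup (inf z a) (- a)\<bar> \<le> a" "\<bar>z - sup (inf z a) (- a)\<bar> \<le> b"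
proof -
  have a: "- a \<le> a" "- b \<le> b" using assms by (metis neg_le_0_iff_le order_trans)+
  show "\<bar>sup (inf z a) (- a)\<bar> \<le> a"
    by (rule abs_leI) (use a in \<open>auto simp: minus_le_iff\<close>)
  have z: "z \<le> a + b" "- z \<le> a + b"
    using assms(1) abs_le_iff by blast+
  define t where "t = sup (inf z a) (- a)"
  have "\<bar>z - t\<bar> \<le> b"
  proof (rule abs_leI)
    have "z - b \<le> inf z a" using z(1) assms(3) by (simp add: diff_le_eq)
    then have "z - b \<le> t" unfolding t_def by (rule le_supI1)
    then show "z - t \<le> b" by (simp add: diff_le_eq add.commute)
    have "- a \<le> z + b" using add_right_mono[OF z(2), of "z - a"] by (simp add: algebra_simps)
    moreover have "inf z a \<le> z + b" using assms(3) by (simp add: le_infI1 add_increasing2)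
    ultimately have "t \<le> z + b" by (simp add: t_def)
    then show "- (z - t) \<le> b" by (simp add: diff_le_eq add.commute)
  qed
  then show "\<bar>z - sup (inf z a) (- a)\<bar> \<le> b" by (simp only: t_def)
qed

lemma order_ideal_mem:
  assumes "order_ideal F" "f \<in> F" "\<bar>x\<bar> \<le> \<bar>f\<bar>"
  shows "x \<in> F"
  using assms unfolding order_ideal_def solid_in_def by blast

text \<open>A lower bound of the truncated set is a lower bound of \<open>D\<close>, hence at most
  zero; the truncations lie in \<open>F\<close> because it is an ideal.\<close>

lemma downward_null_inf_ideal:
  assumes F: "order_ideal F" and f: "f \<in> F" "0 \<le> f" and D: "downward_null UNIV D"
  shows "downward_null F ((\<lambda>d. inf d f) ` D)"
  unfolding downward_null_def
proof (intro conjI ballI impI)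
  have pos: "0 \<le> d" if "d \<in> D" for d using D that by (simp add: downward_null_def)
  show "(\<lambda>d. inf d f) ` D \<subseteq> F"
    using pos f by (auto intro!: order_ideal_mem[OF F f(1)])
  show "(\<lambda>d. inf d f) ` D \<noteq> {}" using D by (simp add: downward_null_def)
  show "0 \<in> F" using vector_sublattice_mem(1)[OF order_ideal_imp_vector_sublattice[OF F]] .
  show "0 \<le> d" if "d \<in> (\<lambda>d. inf d f) ` D" for d using that pos f by auto
  show "\<exists>c\<in>(\<lambda>d. inf d f) ` D. c \<le> a \<and> c \<le> b"
    if ab: "a \<in> (\<lambda>d. inf d f) ` D" "b \<in> (\<lambda>d. inf d f) ` D" for a b
  proof -
    obtain p q where pq: "p \<in> D" "q \<in> D" "a = inf p f" "b = inf q f" using ab by blast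
    then obtain c where "c \<in> D" "c \<le> p" "c \<le> q"
      using D unfolding downward_null_def by blast
    then show ?thesis
      unfolding pq by (intro bexI[of _ "inf c f"]) (auto intro: le_infI1)
  qed
  show "z \<le> 0" if "\<forall>d\<in>(\<lambda>d. inf d f) ` D. z \<le> d" for z
    using that D unfolding downward_null_def by simp
qed

lemma downward_null_scaleR:
  fixes x :: "'a::archimedean_vector_lattice"
  assumes S: "vector_sublattice S" and x: "x \<in> S" "0 \<le> x"
  shows "downward_null S (range (\<lambda>n. (1 / real (Suc n)) *\<^sub>R x))"
proof (rule downward_nullI[OF S])
  show "range (\<lambda>n. (1 / real (Suc n)) *\<^sub>R x) \<subseteq> S"
    using x vector_sublattice_mem(5)[OF S] by blast
  show "0 \<le> d" if "d \<in> range (\<lambda>n. (1 / real (Suc n)) *\<^sub>R x)" for d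
    using that x by (auto intro!: scaleR_nonneg_nonneg)
  have mono: "(1 / real (Suc n)) *\<^sub>R x \<le> (1 / real (Suc m)) *\<^sub>R x" if "m \<le> n" for m n
    using that x by (intro scaleR_right_mono) (auto simp: field_simps)
  show "\<exists>c\<in>range (\<lambda>n. (1 / real (Suc n)) *\<^sub>R x). c \<le> a \<and> c \<le> b"
    if ab: "a \<in> range (\<lambda>n. (1 / real (Suc n)) *\<^sub>R x)" "b \<in> range (\<lambda>n. (1 / real (Suc n)) *\<^sub>R x)"
    for a b
  proof -
    obtain m n where "a = (1 / real (Suc m)) *\<^sub>R x" "b = (1 / real (Suc n)) *\<^sub>R x"
      using ab by blast
    then show ?thesis
      using mono[of m "max m n"] mono[of n "max m n"] by (metis max.cobounded1 max.cobounded2 rangeI)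
  qed
  fix z assume z: "z \<in> S" "0 \<le> z" "\<And>d. d \<in> range (\<lambda>n. (1 / real (Suc n)) *\<^sub>R x) \<Longrightarrow> z \<le> d"
  have "real n *\<^sub>R z \<le> x" for n
  proof -
    have "z \<le> (1 / real (Suc n)) *\<^sub>R x" using z by blast
    from scaleR_left_mono[OF this, of "real (Suc n)"]
    have "real (Suc n) *\<^sub>R z \<le> x" by simp
    moreover have "real n *\<^sub>R z \<le> real (Suc n) *\<^sub>R z"
      using z by (intro scaleR_right_mono) auto
    ultimately show ?thesis by (rule order_trans[rotated])
  qed
  with z(2) show "z = 0" by (rule archimedean)
qed auto

text \<open>The Riesz-Kantorovich formula for the value of the modulus of \<phi> at
  \<open>\<bar>x\<bar>\<close>.\<close>

definition modulus :: "'a::archimedean_vector_lattice set \<Rightarrow> ('a \<Rightarrow> real) \<Rightarrow> 'a \<Rightarrow> real" where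
  "modulus F \<phi> x = Sup (\<phi> ` {y \<in> F. \<bar>y\<bar> \<le> \<bar>x\<bar>})"

context
  fixes F :: "'a::archimedean_vector_lattice set" and \<phi> :: "'a \<Rightarrow> real"
  assumes F: "order_ideal F" and linear: "linear_functional_on F \<phi>"
    and continuous: "order_continuous_on F \<phi>"
begin

lemmas F_mem = vector_sublattice_mem[OF order_ideal_imp_vector_sublattice[OF F]]

lemma linear_functional_add: "x \<in> F \<Longrightarrow> y \<in> F \<Longrightarrow> \<phi> (x + y) = \<phi> x + \<phi> y"
  and linear_functional_scaleR: "x \<in> F \<Longrightarrow> \<phi> (c *\<^sub>R x) = c * \<phi> x"
  using linear by (auto simp: linear_functional_on_def)

lemma linear_functional_zero: "\<phi> 0 = 0"
  using linear_functional_scaleR[of 0 0] F_mem(1) by simp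

lemma linear_functional_minus: "x \<in> F \<Longrightarrow> \<phi> (- x) = - \<phi> x"
  using linear_functional_scaleR[of x "-1"] by simp

text \<open>Order continuity forces order boundedness: if \<phi> exceeded \<open>n + 1\<close> at
  some \<open>y n\<close> with \<open>\<bar>y n\<bar> \<le> \<bar>x\<bar>\<close>, the elements
  \<open>y n / (n + 1)\<close> would converge in order to zero while \<phi> stays above 1 on
  them.\<close>

lemma modulus_bdd_above:
  assumes x: "x \<in> F"
  shows "bdd_above (\<phi> ` {y \<in> F. \<bar>y\<bar> \<le> \<bar>x\<bar>})"
proof (rule ccontr)
  assume not_bdd: "\<not> ?thesis"
  have "\<exists>y. y \<in> F \<and> \<bar>y\<bar> \<le> \<bar>x\<bar> \<and> real (Suc n) < \<phi> y" for n
  proof (rule ccontr)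
    assume "\<nexists>y. y \<in> F \<and> \<bar>y\<bar> \<le> \<bar>x\<bar> \<and> real (Suc n) < \<phi> y"
    then have "bdd_above (\<phi> ` {y \<in> F. \<bar>y\<bar> \<le> \<bar>x\<bar>})"
      by (intro bdd_aboveI2[of _ _ "real (Suc n)"]) (auto simp: not_less)
    with not_bdd show False by simp
  qed
  then obtain y where y: "\<And>n. y n \<in> F" "\<And>n. \<bar>y n\<bar> \<le> \<bar>x\<bar>" "\<And>n. real (Suc n) < \<phi> (y n)"
    by metis
  define v where "v n = (1 / real (Suc n)) *\<^sub>R y n" for n
  have v: "v n \<in> F" "1 < \<phi> (v n)" for n
    using y[of n] F_mem(5) linear_functional_scaleR by (auto simp: v_def field_simps)
  have le: "\<bar>v m\<bar> \<le> (1 / real (Suc n)) *\<^sub>R \<bar>x\<bar>" if "n \<le> m" for m n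
  proof -
    have "\<bar>v m\<bar> = (1 / real (Suc m)) *\<^sub>R \<bar>y m\<bar>" by (simp add: v_def abs_scaleR_eq)
    also have "\<dots> \<le> (1 / real (Suc m)) *\<^sub>R \<bar>x\<bar>" using y by (intro scaleR_left_mono) auto
    also have "\<dots> \<le> (1 / real (Suc n)) *\<^sub>R \<bar>x\<bar>"
      using that by (intro scaleR_right_mono) (auto simp: field_simps)
    finally show ?thesis .
  qed
  have null: "downward_null F (range (\<lambda>n. (1 / real (Suc n)) *\<^sub>R \<bar>x\<bar>))"
    by (rule downward_null_scaleR[OF order_ideal_imp_vector_sublattice[OF F] F_mem(8)[OF x]
          abs_ge_zero])
  have "o_converges F UNIV (\<le>) v 0"
    unfolding o_converges_zero_iff[OF directed_set_nat] tails_nat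
  proof (intro exI[of _ "range (\<lambda>n. (1 / real (Suc n)) *\<^sub>R \<bar>x\<bar>)"] conjI ballI)
    fix d assume "d \<in> range (\<lambda>n. (1 / real (Suc n)) *\<^sub>R \<bar>x\<bar>)"
    then obtain n where "d = (1 / real (Suc n)) *\<^sub>R \<bar>x\<bar>" by blast
    then show "eventually (\<lambda>a. \<bar>v a\<bar> \<le> d) sequentially"
      using le[of n] by (auto simp only: eventually_sequentially)
  qed (rule null)
  then have "((\<lambda>n. \<phi> (v n)) \<longlongrightarrow> 0) (tails UNIV (\<le>))"
    using v by (intro order_continuous_onD[OF continuous directed_set_nat]) auto
  then have "(\<lambda>n. \<phi> (v n)) \<longlonglongrightarrow> 0" by (simp add: tails_nat)
  moreover have "eventually (\<lambda>n. 1 \<le> \<phi> (v n)) sequentially"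
    using v(2) by (simp add: less_imp_le)
  ultimately have "(1::real) \<le> 0"
    by (rule tendsto_lowerbound) simp
  then show False by simp
qed

lemma modulus_ge: "x \<in> F \<Longrightarrow> y \<in> F \<Longrightarrow> \<bar>y\<bar> \<le> \<bar>x\<bar> \<Longrightarrow> \<phi> y \<le> modulus F \<phi> x"
  unfolding modulus_def by (intro cSup_upper modulus_bdd_above) auto

lemma modulus_le:
  assumes "\<And>y. y \<in> F \<Longrightarrow> \<bar>y\<bar> \<le> \<bar>x\<bar> \<Longrightarrow> \<phi> y \<le> c"
  shows "modulus F \<phi> x \<le> c"
  unfolding modulus_def
proof (rule cSup_least)
  have "0 \<in> {y \<in> F. \<bar>y\<bar> \<le> \<bar>x\<bar>}" using F_mem(1) by simp
  then show "\<phi> ` {y \<in> F. \<bar>y\<bar> \<le> \<bar>x\<bar>} \<noteq> {}" by blast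
qed (use assms in auto)

lemma modulus_zero: "modulus F \<phi> 0 = 0"
proof (rule order_antisym)
  show "modulus F \<phi> 0 \<le> 0" by (rule modulus_le) (simp add: linear_functional_zero)
  show "0 \<le> modulus F \<phi> 0" using modulus_ge[of 0 0] F_mem(1) linear_functional_zero by simp
qed

lemma modulus_mono: "y \<in> F \<Longrightarrow> \<bar>x\<bar> \<le> \<bar>y\<bar> \<Longrightarrow> modulus F \<phi> x \<le> modulus F \<phi> y"
  by (rule modulus_le) (auto intro: modulus_ge order_trans)

text \<open>A competitor \<open>z\<close> in the supremum for \<open>x + y\<close> splits, by the
  Riesz decomposition, into competitors for \<open>x\<close> and for \<open>y\<close>.\<close>

lemma modulus_triangle:
  assumes x: "x \<in> F" and y: "y \<in> F"
  shows "modulus F \<phi> (x + y) \<le> modulus F \<phi> x + modulus F \<phi> y"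
proof (rule modulus_le)
  fix z assume z: "z \<in> F" "\<bar>z\<bar> \<le> \<bar>x + y\<bar>"
  then have "\<bar>z\<bar> \<le> \<bar>x\<bar> + \<bar>y\<bar>" using abs_triangle_ineq order_trans by blast
  note dec = Riesz_decomposition[OF this abs_ge_zero abs_ge_zero]
  define w where "w = sup (inf z \<bar>x\<bar>) (- \<bar>x\<bar>)"
  have w: "w \<in> F" unfolding w_def using x z F_mem by simp
  then have "\<phi> z = \<phi> w + \<phi> (z - w)" using linear_functional_add[of w "z - w"] z F_mem(3) by simp
  also have "\<dots> \<le> modulus F \<phi> x + modulus F \<phi> y"
    using w z x y F_mem(3) dec[folded w_def] by (intro add_mono modulus_ge) auto
  finally show "\<phi> z \<le> modulus F \<phi> x + modulus F \<phi> y" .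
qed

text \<open>Competitors for \<open>a\<close> and \<open>b\<close> add up to one for
  \<open>a + b\<close>; the two suprema are taken one after the other.\<close>

lemma modulus_superadditive:
  assumes a: "a \<in> F" "0 \<le> a" and b: "b \<in> F" "0 \<le> b"
  shows "modulus F \<phi> a + modulus F \<phi> b \<le> modulus F \<phi> (a + b)"
proof -
  have "modulus F \<phi> a \<le> modulus F \<phi> (a + b) - modulus F \<phi> b"
  proof (rule modulus_le)
    fix y assume y: "y \<in> F" "\<bar>y\<bar> \<le> \<bar>a\<bar>"
    have "modulus F \<phi> b \<le> modulus F \<phi> (a + b) - \<phi> y"
    proof (rule modulus_le)
      fix z assume z: "z \<in> F" "\<bar>z\<bar> \<le> \<bar>b\<bar>"
      have "\<bar>y + z\<bar> \<le> \<bar>a + b\<bar>"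
        using abs_triangle_ineq[of y z] add_mono[OF y(2) z(2)] a b by simp
      then show "\<phi> z \<le> modulus F \<phi> (a + b) - \<phi> y"
        using modulus_ge[of "a + b" "y + z"] linear_functional_add y z a b F_mem(2) by simp
    qed
    then show "\<phi> y \<le> modulus F \<phi> (a + b) - modulus F \<phi> b" by simp
  qed
  then show ?thesis by simp
qed

text \<open>Fix \<open>y\<close> that attains the supremum for \<open>d\<^sub>0\<close> up to
  \<open>e / 2\<close>. Its truncation \<open>z d\<close> tends to zero in order, so
  \<open>\<phi> (z d)\<close> drops below \<open>e / 2\<close>, while the rest
  \<open>y - z d\<close> is bounded by \<open>d\<^sub>0 - d\<close>. Superadditivity then leaves
  less than \<open>e\<close> for \<open>d\<close>.\<close>

lemma modulus_order_continuous:
  assumes D: "downward_null F D" and e: "0 < e"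
  shows "\<exists>d\<in>D. modulus F \<phi> d < e"
proof -
  note net = downward_null_net[OF D]
  have D': "d \<in> F" "0 \<le> d" if "d \<in> D" for d using D that by (auto simp: downward_null_def)
  obtain d\<^sub>0 where d\<^sub>0: "d\<^sub>0 \<in> D" using D by (auto simp: downward_null_def)
  have "\<exists>y. y \<in> F \<and> \<bar>y\<bar> \<le> d\<^sub>0 \<and> modulus F \<phi> d\<^sub>0 - e / 2 < \<phi> y"
  proof (rule ccontr)
    assume *: "\<not> ?thesis"
    have "modulus F \<phi> d\<^sub>0 \<le> modulus F \<phi> d\<^sub>0 - e / 2"
      by (rule modulus_le) (use * D'(2)[OF d\<^sub>0] in \<open>auto simp: not_less\<close>)
    with e show False by simp
  qed
  then obtain y where y: "y \<in> F" "\<bar>y\<bar> \<le> d\<^sub>0" "modulus F \<phi> d\<^sub>0 - e / 2 < \<phi> y"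
    by blast
  define z where "z d = sup (inf y d) (- d)" for d
  have z: "z d \<in> F" if "d \<in> D" for d unfolding z_def using D'[OF that] y F_mem by simp
  have z_le: "\<bar>z d\<bar> \<le> d" if "d \<in> D" for d
  proof (unfold z_def, rule abs_leI)
    have "- d \<le> d" using D'(2)[OF that] by (metis neg_le_0_iff_le order_trans)
    then show "sup (inf y d) (- d) \<le> d" by simp
    show "- sup (inf y d) (- d) \<le> d" by (simp add: minus_le_iff)
  qed
  have "o_converges F D (\<ge>) z 0"
    unfolding o_converges_zero_iff[OF net(1)] eventually_tails[OF net(1)]
    using D z_le by (meson order_trans)
  then have "((\<lambda>d. \<phi> (z d)) \<longlongrightarrow> 0) (tails D (\<ge>))"
    using z by (intro order_continuous_onD[OF continuous net(1)]) auto
  then have "eventually (\<lambda>d. \<phi> (z d) < e / 2) (tails D (\<ge>))"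
    using e by (intro order_tendstoD(2)) auto
  then obtain c where c: "c \<in> D" "\<And>d. d \<in> D \<Longrightarrow> d \<le> c \<Longrightarrow> \<phi> (z d) < e / 2"
    unfolding eventually_tails[OF net(1)] by blast
  obtain d where d: "d \<in> D" "d \<le> c" "d \<le> d\<^sub>0"
    using D c(1) d\<^sub>0 unfolding downward_null_def by blast
  have diff: "d\<^sub>0 - d \<in> F" "0 \<le> d\<^sub>0 - d" using D'[OF d(1)] D'[OF d\<^sub>0] F_mem(3) d by auto
  have "\<bar>y\<bar> \<le> d + (d\<^sub>0 - d)" using y by simp
  from Riesz_decomposition(2)[OF this D'(2)[OF d(1)] diff(2)]
  have "\<bar>y - z d\<bar> \<le> \<bar>d\<^sub>0 - d\<bar>"
    unfolding z_def abs_of_nonneg[OF diff(2)] .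
  then have "\<phi> (y - z d) \<le> modulus F \<phi> (d\<^sub>0 - d)"
    by (rule modulus_ge[OF diff(1) F_mem(3)[OF y(1) z[OF d(1)]]])
  moreover have "\<phi> y = \<phi> (z d) + \<phi> (y - z d)"
    using linear_functional_add[of "z d" "y - z d"] z[OF d(1)] y F_mem(3) by simp
  moreover have "modulus F \<phi> d + modulus F \<phi> (d\<^sub>0 - d) \<le> modulus F \<phi> d\<^sub>0"
    using modulus_superadditive[OF D'[OF d(1)] diff] by simp
  ultimately have "modulus F \<phi> d < e"
    using c(2)[OF d(1,2)] y(3) by simp
  with d(1) show ?thesis by blast
qed

text \<open>Since \<open>F\<close> is an ideal, \<open>inf \<bar>x\<bar> f\<close> lies in
  \<open>F\<close> for every \<open>x\<close> of the whole space. The scaling clause is order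
  continuity of the modulus along the truncated multiples of \<open>\<bar>x\<bar>\<close>.\<close>

lemma solid_pseudonorm_modulus:
  assumes f: "f \<in> F" "0 \<le> f"
  shows "solid_pseudonorm (\<lambda>x. modulus F \<phi> (inf \<bar>x\<bar> f))"
proof -
  have mem: "inf \<bar>x\<bar> f \<in> F" for x
    using f by (intro order_ideal_mem[OF F f(1)]) simp
  have pos: "\<bar>inf \<bar>x\<bar> f\<bar> = inf \<bar>x\<bar> f" for x using f by simp
  show ?thesis
    unfolding solid_pseudonorm_def
  proof (intro conjI allI impI)
    show "modulus F \<phi> (inf \<bar>0\<bar> f) = 0" using f modulus_zero by (simp add: inf_absorb1)
    show "modulus F \<phi> (inf \<bar>x\<bar> f) \<le> modulus F \<phi> (inf \<bar>y\<bar> f)" if "\<bar>x\<bar> \<le> \<bar>y\<bar>" for x y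
      using that by (intro modulus_mono mem) (simp add: pos le_infI1)
    show "modulus F \<phi> (inf \<bar>x + y\<bar> f) \<le> modulus F \<phi> (inf \<bar>x\<bar> f) + modulus F \<phi> (inf \<bar>y\<bar> f)" for x y
    proof -
      have "inf \<bar>x + y\<bar> f \<le> inf f (\<bar>x\<bar> + \<bar>y\<bar>)"
        using abs_triangle_ineq[of x y] by (simp add: le_infI1)
      also have "\<dots> \<le> inf \<bar>x\<bar> f + inf \<bar>y\<bar> f"
        using inf_add_le[of f "\<bar>x\<bar>" "\<bar>y\<bar>"] f by (simp add: inf.commute)
      finally have "modulus F \<phi> (inf \<bar>x + y\<bar> f) \<le> modulus F \<phi> (inf \<bar>x\<bar> f + inf \<bar>y\<bar> f)"
        using f by (intro modulus_mono F_mem mem) (simp add: pos)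
      also have "\<dots> \<le> modulus F \<phi> (inf \<bar>x\<bar> f) + modulus F \<phi> (inf \<bar>y\<bar> f)"
        by (intro modulus_triangle mem)
      finally show ?thesis .
    qed
    fix x :: 'a and e :: real assume "0 < e"
    have "vector_sublattice (UNIV :: 'a set)" by (simp add: vector_sublattice_def)
    from downward_null_inf_ideal[OF F f downward_null_scaleR[OF this, of "\<bar>x\<bar>"]]
    obtain n where "modulus F \<phi> (inf ((1 / real (Suc n)) *\<^sub>R \<bar>x\<bar>) f) < e"
      using modulus_order_continuous \<open>0 < e\<close> by fastforce
    then show "\<exists>n. modulus F \<phi> (inf \<bar>(1 / real (Suc n)) *\<^sub>R x\<bar> f) < e"
      by (intro exI[of _ n]) (simp add: abs_scaleR_eq)
  qed
qed

text \<open>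
  The test elements \<open>y \<in> F\<close> below \<open>f\<close> along which \<open>u\<close> tends to zero exhaust \<open>f\<close>: an element of \<open>F\<close>
  either meets some element of \<open>G\<close>, which is such a test element, or is disjoint from all
  values of \<open>u\<close>.
\<close>

lemma modulus_eventually_small:
  assumes G: "regular_sublattice G" and u: "eventually (\<lambda>a. u a \<in> G \<and> 0 \<le> u a) L"
    and null: "\<And>g. g \<in> G \<Longrightarrow> 0 \<le> g \<Longrightarrow>
      \<exists>D. downward_null G D \<and> (\<forall>d\<in>D. eventually (\<lambda>a. inf (u a) g \<le> d) L)"
    and f: "f \<in> F" "0 \<le> f" and e: "0 < e"
  shows "eventually (\<lambda>a. modulus F \<phi> (inf (u a) f) < e) L"
proof -
  define Y where
    "Y = {y \<in> F. 0 \<le> y \<and> y \<le> f \<and> (\<forall>e>0. eventually (\<lambda>a. modulus F \<phi> (inf (u a) y) < e) L)}"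
  have ideal: "v \<in> F" if "0 \<le> v" "v \<le> y" "y \<in> F" for v y
    using that by (intro order_ideal_mem[OF F that(3)]) (auto intro: order_trans)
  have mono: "modulus F \<phi> v \<le> modulus F \<phi> w" if "0 \<le> v" "v \<le> w" "w \<in> F" for v w
    using that by (intro modulus_mono) (auto intro: order_trans)
  have split: "modulus F \<phi> (inf v (p + q)) \<le> modulus F \<phi> (inf v p) + modulus F \<phi> (inf v q)"
    if "0 \<le> v" "p \<in> F" "0 \<le> p" "q \<in> F" "0 \<le> q" for v p q
  proof -
    have mem: "inf v p \<in> F" "inf v q \<in> F"
      using ideal[of "inf v p" p] ideal[of "inf v q" q] that by simp_all
    have "modulus F \<phi> (inf v (p + q)) \<le> modulus F \<phi> (inf v p + inf v q)"
      by (rule mono[OF _ inf_add_le F_mem(2)[OF mem]]) (use that in auto)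
    also have "\<dots> \<le> modulus F \<phi> (inf v p) + modulus F \<phi> (inf v q)"
      using mem by (rule modulus_triangle)
    finally show ?thesis .
  qed
  have Y_sub: "y \<in> Y" if "p \<in> Y" "0 \<le> y" "y \<le> p" for p y
  proof -
    have p: "p \<in> F" "p \<le> f" "\<And>e. 0 < e \<Longrightarrow> eventually (\<lambda>a. modulus F \<phi> (inf (u a) p) < e) L"
      using that(1) by (auto simp: Y_def)
    have "eventually (\<lambda>a. modulus F \<phi> (inf (u a) y) < e) L" if "0 < e" for e
      using p(3)[OF that] u
    proof eventually_elim
      case (elim a)
      have "0 \<le> inf (u a) p" using elim \<open>0 \<le> y\<close> \<open>y \<le> p\<close> by (auto intro: order_trans)
      then have "inf (u a) p \<in> F" using inf_le2 p(1) by (rule ideal)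
      then have "modulus F \<phi> (inf (u a) y) \<le> modulus F \<phi> (inf (u a) p)"
        using elim \<open>0 \<le> y\<close> \<open>y \<le> p\<close> by (intro mono) (auto intro: le_infI2)
      with elim show ?case by simp
    qed
    then show ?thesis
      using that p ideal[OF that(2,3) p(1)] unfolding Y_def by (auto intro: order_trans)
  qed
  have add_small: "eventually (\<lambda>a. modulus F \<phi> (inf (u a) (p + q)) < e) L"
    if pq: "p \<in> Y" "q \<in> Y" and e: "0 < e" for p q e
  proof -
    have "eventually (\<lambda>a. modulus F \<phi> (inf (u a) p) < e / 2) L"
      "eventually (\<lambda>a. modulus F \<phi> (inf (u a) q) < e / 2) L"
      using pq e half_gt_zero unfolding Y_def by blast+
    with u show ?thesis
    proof eventually_elim
      case (elim a)
      with pq split[of "u a" p q] show ?case by (auto simp: Y_def)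
    qed
  qed
  have Y_add: "p + q \<in> Y" if "p \<in> Y" "q \<in> Y" "p + q \<le> f" for p q
    using add_small[OF that(1,2)] that F_mem(2) unfolding Y_def by auto
  have null_Y: "downward_null F ((\<lambda>q. f - q) ` Y)"
  proof (rule downward_null_exhaustion[OF order_ideal_imp_vector_sublattice[OF F] f(1)])
    show "0 \<in> Y"
    proof -
      have "eventually (\<lambda>a. modulus F \<phi> (inf (u a) 0) < e) L" if "0 < e" for e
        using u by (rule eventually_mono) (use that modulus_zero in \<open>auto simp: inf_absorb2\<close>)
      then show ?thesis using f F_mem(1) by (auto simp: Y_def)
    qed
    show "sup p q \<in> Y" if "p \<in> Y" "q \<in> Y" for p q
    proof -
      have pq: "p \<in> F" "q \<in> F" "0 \<le> p" "0 \<le> q" "p \<le> f" "q \<le> f" using that by (auto simp: Y_def)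
      have S: "sup p q \<in> F" "0 \<le> sup p q" "sup p q \<le> f"
        using pq F_mem(6) by (auto intro: le_supI1)
      have le: "sup p q \<le> p + q" using pq by (simp add: add_increasing add_increasing2)
      have "eventually (\<lambda>a. modulus F \<phi> (inf (u a) (sup p q)) < e) L" if "0 < e" for e
        using add_small[OF \<open>p \<in> Y\<close> \<open>q \<in> Y\<close> that] u
      proof eventually_elim
        case (elim a)
        have "0 \<le> inf (u a) (p + q)" using elim pq by simp
        then have "inf (u a) (p + q) \<in> F" using inf_le2 F_mem(2)[OF pq(1,2)] by (rule ideal)
        then have "modulus F \<phi> (inf (u a) (sup p q)) \<le> modulus F \<phi> (inf (u a) (p + q))"
          using elim S le by (intro mono) (auto intro: le_infI2)
        with elim show ?case by simp
      qed
      with S show ?thesis by (simp add: Y_def)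
    qed
    show "\<exists>d\<in>Y. 0 < d \<and> d \<le> z" if z: "z \<in> F" "0 < z" "z \<le> f" for z
    proof (cases "\<exists>g\<in>G. 0 \<le> g \<and> inf z g \<noteq> 0")
      case True
      then obtain g where g: "g \<in> G" "0 \<le> g" "inf z g \<noteq> 0" by blast
      let ?w = "inf z g"
      have w: "0 < ?w" "?w \<in> F" "?w \<le> f"
        using g z ideal[of ?w z] by (auto simp: less_le intro: le_infI1)
      from null[OF g(1,2)] obtain D where D: "downward_null G D"
        "\<And>d. d \<in> D \<Longrightarrow> eventually (\<lambda>a. inf (u a) g \<le> d) L" by blast
      \<comment> \<open>The dominating set \<open>D\<close> comes from \<open>G\<close>. Regularity
        and truncation turn it into a set decreasing to zero in \<open>F\<close>, where the modulus
        is order continuous; its members \<open>inf d f\<close> eventually dominate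
        \<open>inf (u a) ?w\<close>.\<close>
      from downward_null_inf_ideal[OF F f regular_downward_null[OF G D(1)]]
      have D': "downward_null F ((\<lambda>d. inf d f) ` D)" .
      have "eventually (\<lambda>a. modulus F \<phi> (inf (u a) ?w) < e) L" if e: "0 < e" for e
      proof -
        obtain d where d: "d \<in> D" "modulus F \<phi> (inf d f) < e"
          using modulus_order_continuous[OF D' e] by blast
        have "inf d f \<in> F" using D' d(1) by (auto simp: downward_null_def)
        from D(2)[OF d(1)] u show ?thesis
        proof eventually_elim
          case (elim a)
          have "inf (u a) ?w \<le> inf (u a) g" by (intro inf_mono) simp_all
          also have "\<dots> \<le> d" using elim by simp
          finally have le: "inf (u a) ?w \<le> inf d f" using w(3) by (simp add: le_infI2)
          have "modulus F \<phi> (inf (u a) ?w) \<le> modulus F \<phi> (inf d f)"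
            by (rule mono[OF _ le \<open>inf d f \<in> F\<close>]) (use elim g(2) z(2) in simp)
          with d show ?case by simp
        qed
      qed
      with w g(2) less_imp_le[OF z(2)] have "?w \<in> Y" by (simp add: Y_def)
      with w show ?thesis by (intro bexI[of _ ?w]) auto
    next
      case False
      have "eventually (\<lambda>a. modulus F \<phi> (inf (u a) z) < e) L" if "0 < e" for e
        using u
      proof eventually_elim
        case (elim a)
        then have "inf (u a) z = 0" using False by (metis inf.commute)
        with that modulus_zero show ?case by simp
      qed
      with z show ?thesis by (intro bexI[of _ z]) (auto simp: Y_def)
    qed
  qed (use Y_add in \<open>auto simp: Y_def\<close>)
  \<comment> \<open>Splitting \<open>f\<close> into \<open>y\<close> and \<open>f - y\<close> leaves
    an error below \<open>e / 2\<close> that does not depend on \<open>a\<close>.\<close>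
  obtain y where y: "y \<in> Y" "modulus F \<phi> (f - y) < e / 2"
    using modulus_order_continuous[OF null_Y, of "e / 2"] e by auto
  have yF: "y \<in> F" "0 \<le> y" "f - y \<in> F" "0 \<le> f - y"
    using y(1) f F_mem(3) by (auto simp: Y_def)
  have "eventually (\<lambda>a. modulus F \<phi> (inf (u a) y) < e / 2) L"
    using y(1) e half_gt_zero unfolding Y_def by blast
  with u show ?thesis
  proof eventually_elim
    case (elim a)
    have "modulus F \<phi> (inf (u a) f) \<le> modulus F \<phi> (inf (u a) y) + modulus F \<phi> (inf (u a) (f - y))"
      using split[of "u a" y "f - y"] yF elim by simp
    moreover have "modulus F \<phi> (inf (u a) (f - y)) \<le> modulus F \<phi> (f - y)"
      using yF elim by (intro mono) auto
    ultimately show ?case using elim y(2) by linarith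
  qed
qed

end

text \<open>For the Hausdorff property, order density puts some \<open>f\<close> from
  \<open>F\<close> below \<open>\<bar>x\<bar>\<close>, and \<open>f\<close> itself is taken as the
  truncation: then \<open>inf \<bar>x\<bar> f = f\<close>, and one of \<open>\<phi> f\<close>,
  \<open>\<phi> (- f)\<close> is positive for a suitable \<phi>. The convergence clause is
  \<open>modulus_eventually_small\<close> for \<open>\<bar>x a - l\<bar>\<close>.\<close>

lemma exists_Hausdorff_uo_Lebesgue:
  fixes F G :: "'a::archimedean_vector_lattice set"
  assumes F: "order_ideal F" and dense: "order_dense F"
    and sep: "separates_points (order_continuous_dual F) F" and G: "regular_sublattice G"
  shows "\<exists>\<tau>. Hausdorff_space \<tau> \<and> uo_Lebesgue G \<tau>"
proof -
  define R where "R = {\<lambda>x. modulus F \<phi> (inf \<bar>x\<bar> f) |\<phi> f. \<phi> \<in> order_continuous_dual F \<and> f \<in> F \<and> 0 \<le> f}"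
  have G': "vector_sublattice G" using G by (simp add: regular_sublattice_def)
  have dual: "linear_functional_on F \<phi>" "order_continuous_on F \<phi>" if "\<phi> \<in> order_continuous_dual F" for \<phi>
    using that by (auto simp: order_continuous_dual_def)
  have R: "solid_pseudonorm \<rho>" if "\<rho> \<in> R" for \<rho>
    using that dual solid_pseudonorm_modulus[OF F] unfolding R_def by blast
  have "Hausdorff_space (pseudonorm_topology G R)"
  proof (rule Hausdorff_pseudonorm[OF G' R])
    fix x assume "x \<in> G" "x \<noteq> 0"
    then obtain f where f: "f \<in> F" "0 < f" "f \<le> \<bar>x\<bar>"
      using dense zero_less_abs_iff unfolding order_dense_def by blast
    have F0: "0 \<in> F" using F by (simp add: order_ideal_def subspace_0)
    obtain \<phi> where \<phi>: "\<phi> \<in> order_continuous_dual F" "\<phi> f \<noteq> \<phi> 0"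
      using sep f F0 unfolding separates_points_def by (metis less_irrefl)
    note \<phi>' = F dual[OF \<phi>(1)]
    have "\<phi> f \<noteq> 0" using \<phi>(2) linear_functional_zero[OF \<phi>'] by simp
    moreover have "\<phi> f \<le> modulus F \<phi> f" "\<phi> (- f) \<le> modulus F \<phi> f"
      using f F by (auto intro!: modulus_ge[OF \<phi>'] simp: order_ideal_def subspace_neg)
    ultimately have "0 < modulus F \<phi> f" using linear_functional_minus[OF \<phi>' f(1)] by linarith
    moreover have "inf \<bar>x\<bar> f = f" using f by (simp add: inf_absorb2)
    moreover have "(\<lambda>x. modulus F \<phi> (inf \<bar>x\<bar> f)) \<in> R"
      using \<phi>(1) f less_imp_le unfolding R_def by blast
    ultimately show "\<exists>\<rho>\<in>R. 0 < \<rho> x"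
      by (intro bexI[of _ "\<lambda>x. modulus F \<phi> (inf \<bar>x\<bar> f)"]) auto
  qed
  moreover have "uo_Lebesgue G (pseudonorm_topology G R)"
    unfolding uo_Lebesgue_def
  proof (intro conjI allI impI linear_topology_pseudonorm[OF G' R] locally_solid_pseudonorm[OF G' R])
    fix A :: "'a net_index set" and le x l
    assume *: "directed_set A le \<and> x ` A \<subseteq> G \<and> l \<in> G \<and> uo_converges G A le x l"
    then have A: "directed_set A le" by blast
    have mem: "eventually (\<lambda>a. x a \<in> G) (tails A le)"
      using * A unfolding eventually_tails[OF A] directed_set_def by blast
    have u: "eventually (\<lambda>a. \<bar>x a - l\<bar> \<in> G \<and> 0 \<le> \<bar>x a - l\<bar>) (tails A le)"
      using mem by (rule eventually_mono) (use * vector_sublattice_mem(3,8)[OF G'] in simp)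
    show "limitin (pseudonorm_topology G R) x l (tails A le)"
    proof (subst limitin_pseudonorm_topology[OF G' R], assumption, intro conjI ballI allI impI mem)
      show "l \<in> G" using * by blast
      fix \<rho> e assume "\<rho> \<in> R" and e: "0 < (e::real)"
      then obtain \<phi> f where \<rho>: "\<rho> = (\<lambda>x. modulus F \<phi> (inf \<bar>x\<bar> f))" "\<phi> \<in> order_continuous_dual F"
          "f \<in> F" "0 \<le> f" unfolding R_def by blast
      have "\<exists>D. downward_null G D \<and> (\<forall>d\<in>D. eventually (\<lambda>a. inf \<bar>x a - l\<bar> g \<le> d) (tails A le))"
        if "g \<in> G" "0 \<le> g" for g
        using * that unfolding uo_converges_iff[OF A] by blast
      from modulus_eventually_small[OF F dual[OF \<rho>(2)] G u this \<rho>(3,4) e]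
      show "eventually (\<lambda>a. \<rho> (x a - l) < e) (tails A le)" by (simp add: \<rho>(1))
    qed
  qed
  ultimately show ?thesis by blast
qed

section \<open>Uniqueness\<close>

lemma (in hausdorff_uo_Lebesgue) openin_if_uo_Lebesgue:
  assumes \<sigma>: "uo_Lebesgue S \<sigma>" and U: "openin \<sigma> U"
  shows "openin \<tau> U"
proof (subst openin_subopen, rule ballI, rule ccontr)
  fix l assume l: "l \<in> U" and none: "\<not> (\<exists>T. openin \<tau> T \<and> l \<in> T \<and> T \<subseteq> U)"
  have "topspace \<sigma> = S" using \<sigma> by (simp add: uo_Lebesgue_def linear_topology_def)
  then have lS: "l \<in> S" using l openin_subset[OF U] by blast
  \<comment> \<open>The trace on \<open>S - U\<close> of the neighbourhoods of \<open>l\<close> in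
    \<open>\<tau>\<close> is a proper filter exactly because none of them lies inside
    \<open>U\<close>.\<close>
  define L where "L = inf (nhdsin \<tau> l) (principal (S - U))"
  have ev: "eventually P L \<longleftrightarrow> (\<exists>T. openin \<tau> T \<and> l \<in> T \<and> (\<forall>v\<in>T. v \<in> S - U \<longrightarrow> P v))" for P
    unfolding L_def using lS topspace by (simp add: eventually_inf_principal eventually_nhdsin)
  have L: "L \<noteq> bot"
  proof
    assume "L = bot"
    then have "eventually (\<lambda>_. False) L" by simp
    then obtain T where T: "openin \<tau> T" "l \<in> T" "\<forall>v\<in>T. \<not> v \<in> S - U" unfolding ev by blast
    then have "T \<subseteq> U" using openin_subset[OF T(1)] topspace by auto
    with T none show False by blast
  qed
  have A: "eventually (\<lambda>v. v \<in> S - U) L"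
    unfolding L_def by (simp add: eventually_inf_principal)
  then obtain a\<^sub>0 where a\<^sub>0: "a\<^sub>0 \<in> S - U" using L eventually_happens' by blast
  have lim: "limitin \<tau> (\<lambda>v. v) l L"
    unfolding limitin_def ev using lS topspace by auto
  obtain \<alpha> where \<alpha>: "\<And>n. \<alpha> n \<in> S - U" "uo_converges S (UNIV :: nat set) (\<le>) \<alpha> l"
    by (rule uo_convergent_selection[OF lim L _ a\<^sub>0, where R = "\<lambda>_ _ _. True"]) (use A in auto)
  have "range \<alpha> \<subseteq> S" using \<alpha>(1) by blast
  then have "limitin \<sigma> \<alpha> l (tails UNIV (\<le>))"
    using uo_LebesgueD[OF \<sigma> directed_set_nat _ lS \<alpha>(2)] by blast
  then have "eventually (\<lambda>n. \<alpha> n \<in> U) sequentially"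
    using U l unfolding limitin_def tails_nat by blast
  then show False using \<alpha>(1) eventually_happens'[OF sequentially_bot] by blast
qed

theorem theorem7p8:
  fixes F G :: "'a::archimedean_vector_lattice set"
  assumes "countable_sup_property (UNIV :: 'a set)"
    and "order_ideal F" and "order_dense F"
    and "separates_points (order_continuous_dual F) F"
    and "regular_sublattice G"
  shows "(\<exists>!\<tau>. Hausdorff_space \<tau> \<and> uo_Lebesgue G \<tau>) \<and>
    (\<forall>\<tau>. Hausdorff_space \<tau> \<and> uo_Lebesgue G \<tau> \<longrightarrow>
      (\<forall>(A :: 'i set) le x l \<alpha>'.
         directed_set A le \<and> x ` A \<subseteq> G \<and> l \<in> G \<and> limitin \<tau> x l (tails A le) \<and>
         (\<forall>n::nat. \<alpha>' n \<in> A) \<longrightarrow>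
         (\<exists>\<alpha> :: nat \<Rightarrow> 'i. (\<forall>n. \<alpha> n \<in> A) \<and> \<alpha> 0 = \<alpha>' 0 \<and> (\<forall>n. le (\<alpha> n) (\<alpha> (Suc n))) \<and>
            (\<forall>n. le (\<alpha>' n) (\<alpha> n)) \<and>
            uo_converges G UNIV (\<le>) (\<lambda>n. x (\<alpha> n)) l)) \<and>
      (\<forall>(x :: nat \<Rightarrow> 'a) l.
         range x \<subseteq> G \<and> l \<in> G \<and> limitin \<tau> x l sequentially \<longrightarrow>
         (\<exists>k :: nat \<Rightarrow> nat. strict_mono k \<and>
            uo_converges G UNIV (\<le>) (\<lambda>n. x (k n)) l)))"
proof (intro conjI allI impI)
  have G: "vector_sublattice G" using assms(5) by (simp add: regular_sublattice_def)
  have loc: "hausdorff_uo_Lebesgue G \<tau>" if "Hausdorff_space \<tau> \<and> uo_Lebesgue G \<tau>" for \<tau>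
    using that G regular_countable_glb[OF assms(1,5)] by unfold_locales auto
  show "\<exists>!\<tau>. Hausdorff_space \<tau> \<and> uo_Lebesgue G \<tau>"
  proof (rule ex_ex1I)
    show "\<exists>\<tau>. Hausdorff_space \<tau> \<and> uo_Lebesgue G \<tau>"
      using assms(2-5) by (rule exists_Hausdorff_uo_Lebesgue)
    fix \<tau> \<sigma> assume *: "Hausdorff_space \<tau> \<and> uo_Lebesgue G \<tau>" "Hausdorff_space \<sigma> \<and> uo_Lebesgue G \<sigma>"
    show "\<tau> = \<sigma>"
      unfolding topology_eq
      using hausdorff_uo_Lebesgue.openin_if_uo_Lebesgue[OF loc[OF *(1)]]
        hausdorff_uo_Lebesgue.openin_if_uo_Lebesgue[OF loc[OF *(2)]] * by blast
  qed
  fix \<tau> :: "'a topology" assume \<tau>: "Hausdorff_space \<tau> \<and> uo_Lebesgue G \<tau>"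
  interpret hausdorff_uo_Lebesgue G \<tau> using \<tau> by (rule loc)
  {
    fix A :: "'i set" and le x l \<alpha>'
    assume *: "directed_set A le \<and> x ` A \<subseteq> G \<and> l \<in> G \<and> limitin \<tau> x l (tails A le) \<and>
      (\<forall>n::nat. \<alpha>' n \<in> A)"
    then have A: "directed_set A le" by blast
    then have refl: "le a a" if "a \<in> A" for a
      using that by (auto simp: directed_set_def reflp_on_def)
    have trans: "le a c" if "le a b" "le b c" "a \<in> A" "b \<in> A" "c \<in> A" for a b c
      using A that unfolding directed_set_def transp_on_def by blast
    have nontriv: "tails A le \<noteq> bot"
      unfolding trivial_limit_def eventually_tails[OF A] using refl by blast
    \<comment> \<open>The demand at step \<open>n\<close> concerns the prescribed index
      \<open>n + 1\<close>; index 0 is the starting point and is settled by reflexivity.\<close>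
    have ev: "eventually (\<lambda>b. b \<in> A \<and> (le a b \<and> le (\<alpha>' (Suc n)) b)) (tails A le)"
      if "a \<in> A" for n a
    proof -
      have "\<alpha>' (Suc n) \<in> A" using * by blast
      then obtain c where "c \<in> A" "le a c" "le (\<alpha>' (Suc n)) c"
        using A \<open>a \<in> A\<close> unfolding directed_set_def by blast
      then show ?thesis
        unfolding eventually_tails[OF A] using trans \<open>a \<in> A\<close> \<open>\<alpha>' (Suc n) \<in> A\<close> by blast
    qed
    have lim: "limitin \<tau> x l (tails A le)" and x: "x ` A \<subseteq> G" and a\<^sub>0: "\<alpha>' 0 \<in> A"
      using * by blast+
    obtain \<alpha> where \<alpha>: "\<alpha> 0 = \<alpha>' 0" "\<And>n. \<alpha> n \<in> A"
        "\<And>n. le (\<alpha> n) (\<alpha> (Suc n)) \<and> le (\<alpha>' (Suc n)) (\<alpha> (Suc n))"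
        "uo_converges G (UNIV :: nat set) (\<le>) (\<lambda>n. x (\<alpha> n)) l"
      by (rule uo_convergent_selection[OF lim nontriv x a\<^sub>0]) (rule ev, assumption, rule that)
    have "le (\<alpha>' n) (\<alpha> n)" for n
      using \<alpha>(1,3) refl[OF a\<^sub>0] by (cases n) auto
    with \<alpha>(1,2,4) conjunct1[OF \<alpha>(3)]
    show "\<exists>\<alpha> :: nat \<Rightarrow> 'i. (\<forall>n. \<alpha> n \<in> A) \<and> \<alpha> 0 = \<alpha>' 0 \<and>
        (\<forall>n. le (\<alpha> n) (\<alpha> (Suc n))) \<and> (\<forall>n. le (\<alpha>' n) (\<alpha> n)) \<and> uo_converges G UNIV (\<le>) (\<lambda>n. x (\<alpha> n)) l"
      by blast
  }
  fix x :: "nat \<Rightarrow> 'a" and l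
  assume *: "range x \<subseteq> G \<and> l \<in> G \<and> limitin \<tau> x l sequentially"
  then have lim: "limitin \<tau> x l sequentially" and x: "range x \<subseteq> G" by blast+
  \<comment> \<open>A subsequence needs strictly increasing indices, whereas the net statement
    yields only \<open>\<le>\<close>; hence the selection is repeated with \<open><\<close> as the
    relation.\<close>
  have ev: "eventually (\<lambda>b. b \<in> UNIV \<and> a < b) sequentially" for a :: nat
    using eventually_gt_at_top[of a] by simp
  obtain k :: "nat \<Rightarrow> nat" where k: "\<And>n. k n < k (Suc n)"
      "uo_converges G (UNIV :: nat set) (\<le>) (\<lambda>n. x (k n)) l"
    by (rule uo_convergent_selection[OF lim sequentially_bot x UNIV_I ev]) (rule that)
  then show "\<exists>k :: nat \<Rightarrow> nat. strict_mono k \<and> uo_converges G UNIV (\<le>) (\<lambda>n. x (k n)) l"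
    unfolding strict_mono_Suc_iff by blast
qed

end
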